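(* Let $A$ be a coset nilprogression in a group $G$, of derived length $l$ and ranks $r_1,\ldots,r_l$. Then $$|A^{\pm n}| \ll_{l,r_1,\ldots,r_l} n^{O_{l,r_1,\ldots,r_l}(1)} |A|$$ for all integers $n \ge 1$.
   Context: Notation. For subsets of a group $G$: $A\cdot B := \{ab: a\in A,b\in B\}$, $A^{-1}:=\{a^{-1}:a\in A\}$, $A^k := A\cdots A$ ($k$ factors), $A^{\pm k} := (A\cup\{1\}\cup A^{-1})^k$. $[g,h] := ghg^{-1}h^{-1}$. $X \ll_{p} Y$ means $|X|\le C_p Y$ with $C_p$ depending only on the parameters $p$; $O_p(1)$ denotes a quantity bounded in terms of $p$ only. Coset nilprogression. Let $G$ be a group and $l\ge 0$ an integer. For each $1\le i\le l$, let $r_i\ge 0$ be an integer, let $H_{i,0}=(H_{i,0},+)$ be a finite abelian group, and let $H_{i,j}:=\{-N_{i,j},\ldots,N_{i,j}\}$ for $1\le j\le r_i$ be intervals of integers. Suppose we have maps $\phi_{i,j}:H_{i,j}\to G$ for $0\le j\le r_i$; write $A_i := \phi_{i,0}(H_{i,0})\cdot\ldots\cdot\phi_{i,r_i}(H_{i,r_i})$ and $A_{\ge i}:=A_l\cdot A_{l-1}\cdot\ldots\cdot A_i$ (with $A_{\ge l+1}=\{1\}$). Suppose that: (1) $\phi_{i,j}(0)=1$ for all $1\le i\le l$, $0\le j\le r_i$; (2) for $1\le i\le l$, $0\le j\le r_i$ and $n,n'\in H_{i,j}$ with $n+n'\in H_{i,j}$: $\phi_{i,j}(n)\phi_{i,j}(n')\in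 A_{\ge i+1}\cdot\phi_{i,j}(n+n')$; (3) for $1\le i\le l$, $0\le j,j'\le r_i$, $n\in H_{i,j}$, $n'\in H_{i,j'}$: $[\phi_{i,j}(n),\phi_{i,j'}(n')]\in A_{\ge i+1}$; (4) for $1\le i'<i\le l$, $0\le j\le r_i$, $0\le j'\le r_{i'}$, $n\in H_{i,j}$, $n'\in H_{i',j'}$: $[\phi_{i',j'}(n'),\phi_{i,j}(n)]\in A_{\ge i+1}\cdot\phi_{i,0}(H_{i,0})\cdot\ldots\cdot\phi_{i,\max(j-1,0)}(H_{i,\max(j-1,0)})$. Then $A_{\ge 1}$ is called a coset nilprogression in $G$ of derived length $l$, ranks $r_1,\ldots,r_l$ and volume $\prod_{i=1}^l\prod_{j=0}^{r_i}|H_{i,j}|$ (if $l=0$, $A_{\ge1}=\{1\}$). *)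

theory Defs
  imports Complex_Main "HOL-Algebra.Coset"
begin

section \<open>Product sets in a group\<close>

text \<open>The ordered product \<open>X\<^sub>1 \<cdot> \<dots> \<cdot> X\<^sub>k\<close>; the empty product is \<open>{\<one>}\<close>.\<close>

definition set_prod :: "'a monoid \<Rightarrow> 'a set list \<Rightarrow> 'a set" where
  "set_prod G Xs = foldr (\<lambda>X Y. X <#>\<^bsub>G\<^esub> Y) Xs {\<one>\<^bsub>G\<^esub>}"

text \<open>\<open>A\<^sup>\<plusminus>\<^sup>n = (A \<union> {1} \<union> A\<^sup>-\<^sup>1)\<^sup>n\<close>\<close>

definition sym_power :: "'a monoid \<Rightarrow> 'a set \<Rightarrow> nat \<Rightarrow> 'a set" where
  "sym_power G A n = set_prod G (replicate n (A \<union> {\<one>\<^bsub>G\<^esub>} \<union> set_inv\<^bsub>G\<^esub> A))"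

definition commutator :: "'a monoid \<Rightarrow> 'a \<Rightarrow> 'a \<Rightarrow> 'a" where
  "commutator G g h = g \<otimes>\<^bsub>G\<^esub> h \<otimes>\<^bsub>G\<^esub> inv\<^bsub>G\<^esub> g \<otimes>\<^bsub>G\<^esub> inv\<^bsub>G\<^esub> h"

section \<open>Coset nilprogressions\<close>

text \<open>
  The index sets \<open>H\<^sub>i\<^sub>,\<^sub>0\<close> (a finite abelian group) and \<open>H\<^sub>i\<^sub>,\<^sub>j = {-N\<^sub>i\<^sub>,\<^sub>j, \<dots>, N\<^sub>i\<^sub>,\<^sub>j}\<close> for \<open>j \<ge> 1\<close> are
  placed in one sum type: \<open>Inl\<close> tags elements of the groups \<open>H i\<close>, \<open>Inr\<close> tags integers.
  The groups \<open>H i\<close> are written multiplicatively by the library, so \<open>\<otimes>\<close> and \<open>\<one>\<close> of \<open>H i\<close>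
  are the addition and the zero of \<open>H\<^sub>i\<^sub>,\<^sub>0\<close>. Values \<open>N i 0\<close> are never used.
\<close>

definition idx :: "(nat \<Rightarrow> 'h monoid) \<Rightarrow> (nat \<Rightarrow> nat \<Rightarrow> nat) \<Rightarrow> nat \<Rightarrow> nat \<Rightarrow> ('h + int) set" where
  "idx H N i j = (if j = 0 then Inl ` carrier (H i) else Inr ` {- int (N i j)..int (N i j)})"

definition idx_zero :: "(nat \<Rightarrow> 'h monoid) \<Rightarrow> nat \<Rightarrow> nat \<Rightarrow> 'h + int" where
  "idx_zero H i j = (if j = 0 then Inl \<one>\<^bsub>H i\<^esub> else Inr 0)"

text \<open>Only applied to two elements of the same \<open>idx H N i j\<close>, so the mixed case is irrelevant.\<close>

definition idx_add :: "(nat \<Rightarrow> 'h monoid) \<Rightarrow> nat \<Rightarrow> 'h + int \<Rightarrow> 'h + int \<Rightarrow> 'h + int" where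
  "idx_add H i x y =
     (case (x, y) of (Inl a, Inl b) \<Rightarrow> Inl (a \<otimes>\<^bsub>H i\<^esub> b)
                   | (Inr m, Inr n) \<Rightarrow> Inr (m + n)
                   | _ \<Rightarrow> undefined)"

text \<open>\<open>\<phi>\<^sub>i\<^sub>,\<^sub>0(H\<^sub>i\<^sub>,\<^sub>0) \<cdot> \<dots> \<cdot> \<phi>\<^sub>i\<^sub>,\<^sub>k(H\<^sub>i\<^sub>,\<^sub>k)\<close>; for \<open>k = r i\<close> this is \<open>A\<^sub>i\<close>.\<close>

definition layer_upto ::
  "'a monoid \<Rightarrow> (nat \<Rightarrow> 'h monoid) \<Rightarrow> (nat \<Rightarrow> nat \<Rightarrow> nat) \<Rightarrow> (nat \<Rightarrow> nat \<Rightarrow> 'h + int \<Rightarrow> 'a)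
     \<Rightarrow> nat \<Rightarrow> nat \<Rightarrow> 'a set" where
  "layer_upto G H N \<phi> i k = set_prod G (map (\<lambda>j. \<phi> i j ` idx H N i j) [0..<Suc k])"

text \<open>\<open>A\<^sub>\<ge>\<^sub>i = A\<^sub>l \<cdot> A\<^sub>l\<^sub>-\<^sub>1 \<cdot> \<dots> \<cdot> A\<^sub>i\<close>, with decreasing indices from left to right.\<close>

definition layers_from ::
  "'a monoid \<Rightarrow> nat \<Rightarrow> (nat \<Rightarrow> nat) \<Rightarrow> (nat \<Rightarrow> 'h monoid) \<Rightarrow> (nat \<Rightarrow> nat \<Rightarrow> nat)
     \<Rightarrow> (nat \<Rightarrow> nat \<Rightarrow> 'h + int \<Rightarrow> 'a) \<Rightarrow> nat \<Rightarrow> 'a set" where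
  "layers_from G l r H N \<phi> i =
     set_prod G (map (\<lambda>k. layer_upto G H N \<phi> k (r k)) (rev [i..<Suc l]))"

text \<open>
  In the last assumption the truncated subtraction \<open>j - 1\<close> on \<open>nat\<close> is \<open>max (j - 1) 0\<close>.
\<close>

locale coset_nilprogression =
  fixes G :: "'a monoid"
    and l :: nat
    and r :: "nat \<Rightarrow> nat"
    and H :: "nat \<Rightarrow> 'h monoid"
    and N :: "nat \<Rightarrow> nat \<Rightarrow> nat"
    and \<phi> :: "nat \<Rightarrow> nat \<Rightarrow> 'h + int \<Rightarrow> 'a"
  assumes group_G: "group G"
    and comm_group_H: "\<lbrakk>1 \<le> i; i \<le> l\<rbrakk> \<Longrightarrow> comm_group (H i)"
    and finite_H: "\<lbrakk>1 \<le> i; i \<le> l\<rbrakk> \<Longrightarrow> finite (carrier (H i))"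
    and phi_closed:
      "\<lbrakk>1 \<le> i; i \<le> l; j \<le> r i; x \<in> idx H N i j\<rbrakk> \<Longrightarrow> \<phi> i j x \<in> carrier G"
    and phi_zero:
      "\<lbrakk>1 \<le> i; i \<le> l; j \<le> r i\<rbrakk> \<Longrightarrow> \<phi> i j (idx_zero H i j) = \<one>\<^bsub>G\<^esub>"
    and phi_add:
      "\<lbrakk>1 \<le> i; i \<le> l; j \<le> r i; x \<in> idx H N i j; y \<in> idx H N i j;
        idx_add H i x y \<in> idx H N i j\<rbrakk>
       \<Longrightarrow> \<phi> i j x \<otimes>\<^bsub>G\<^esub> \<phi> i j y
             \<in> layers_from G l r H N \<phi> (i + 1) <#>\<^bsub>G\<^esub> {\<phi> i j (idx_add H i x y)}"
    and phi_commutator_same: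
      "\<lbrakk>1 \<le> i; i \<le> l; j \<le> r i; j' \<le> r i; x \<in> idx H N i j; y \<in> idx H N i j'\<rbrakk>
       \<Longrightarrow> commutator G (\<phi> i j x) (\<phi> i j' y) \<in> layers_from G l r H N \<phi> (i + 1)"
    and phi_commutator_lower:
      "\<lbrakk>1 \<le> i'; i' < i; i \<le> l; j \<le> r i; j' \<le> r i'; x \<in> idx H N i j; y \<in> idx H N i' j'\<rbrakk>
       \<Longrightarrow> commutator G (\<phi> i' j' y) (\<phi> i j x)
             \<in> layers_from G l r H N \<phi> (i + 1) <#>\<^bsub>G\<^esub> layer_upto G H N \<phi> i (j - 1)"

section \<open>Polynomial growth with uniform constants\<close>

text \<open>
  \<open>|A\<^sup>\<plusminus>\<^sup>n| \<le> C n\<^sup>d |A|\<close> for all coset nilprogressions \<open>A = A\<^sub>\<ge>\<^sub>1\<close> of derived length \<open>l\<close> and ranks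
  \<open>r 1, \<dots>, r l\<close> in groups over the type \<open>'a\<close>, with finite abelian groups over the type \<open>'h\<close>.
  All sets involved are finite, so \<open>card\<close> is their true cardinality.

  The pair of types is a parameter so that \<open>C\<close> and \<open>d\<close> can be stated not to depend on it:
  a bare \<open>\<exists>C d. growth_bound TYPE('a) TYPE('h) l r C d\<close> would allow different constants for
  different types, whereas \<open>C\<close> and \<open>d\<close> should depend on \<open>l\<close> and \<open>r 1, \<dots>, r l\<close> only.
\<close>

definition growth_bound ::
  "'a itself \<Rightarrow> 'h itself \<Rightarrow> nat \<Rightarrow> (nat \<Rightarrow> nat) \<Rightarrow> real \<Rightarrow> nat \<Rightarrow> bool" where
  "growth_bound TA TH l r C d \<longleftrightarrow>
     (\<forall>(G :: 'a monoid) (H :: nat \<Rightarrow> 'h monoid) N \<phi> A n.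
        coset_nilprogression G l r H N \<phi> \<longrightarrow> A = layers_from G l r H N \<phi> 1 \<longrightarrow> 1 \<le> n \<longrightarrow>
        real (card (sym_power G A n)) \<le> C * real n ^ d * real (card A))"

end

theory Submission
  imports Defs "HOL-Library.Multiset" "HOL-Library.FuncSet" "HOL-Library.Countable_Set"
    "HOL-Algebra.Generated_Groups"
begin

text \<open>
  By downward induction on \<open>i\<close>, every word of length \<open>n\<close> in the letters \<open>\<phi> k j x\<close> with \<open>k \<ge> i\<close> lies in
  one of polynomially many left translates of \<open>A\<^sub>\<ge>\<^sub>i\<close>. In such a word the letters of layer \<open>i\<close>
  are moved to the right. Conjugating a letter of a later layer by \<open>m\<close> letters of layer \<open>i\<close> gives
  a word whose length is polynomial in \<open>m\<close>, because every commutator consists of letters of smaller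
  rank. Up to such words the letters of layer \<open>i\<close> commute, and two letters of the same kind \<open>j\<close> merge
  into one, up to an overflow letter \<open>\<phi> i j (\<plusminus>N)\<close>. So the word becomes
  \<open>w' \<cdot> y \<cdot> a\<close> with \<open>a \<in> A\<^sub>i\<close>, a product \<open>y\<close> of overflow letters that depends only on their
  multiplicities, and a word \<open>w'\<close> of polynomial length in later layers. Moving \<open>y\<close> to the front, where
  it only contributes a translate, leaves a word to which the induction hypothesis applies.
\<close>

section \<open>Product sets and words\<close>

definition lprod :: "('a, 'b) monoid_scheme \<Rightarrow> 'a list \<Rightarrow> 'a" where
  "lprod G xs = foldr (\<lambda>x y. x \<otimes>\<^bsub>G\<^esub> y) xs \<one>\<^bsub>G\<^esub>"

lemma lprod_Nil [simp]: "lprod G [] = \<one>\<^bsub>G\<^esub>"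
  and lprod_Cons [simp]: "lprod G (x # xs) = x \<otimes>\<^bsub>G\<^esub> lprod G xs"
  by (simp_all add: lprod_def)

abbreviation set_power :: "'a monoid \<Rightarrow> 'a set \<Rightarrow> nat \<Rightarrow> 'a set" where
  "set_power G T n \<equiv> set_prod G (replicate n T)"

lemma set_prod_Nil [simp]: "set_prod G [] = {\<one>\<^bsub>G\<^esub>}"
  and set_prod_Cons [simp]: "set_prod G (X # Xs) = X <#>\<^bsub>G\<^esub> set_prod G Xs"
  by (simp_all add: set_prod_def)

lemma mem_set_mult: "x \<in> X <#>\<^bsub>G\<^esub> Y \<longleftrightarrow> (\<exists>a\<in>X. \<exists>b\<in>Y. x = a \<otimes>\<^bsub>G\<^esub> b)"
  by (auto simp: set_mult_def)

lemma finite_set_mult: "finite X \<Longrightarrow> finite Y \<Longrightarrow> finite (X <#>\<^bsub>G\<^esub> Y)"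
  by (simp add: set_mult_def)

lemma card_set_mult_le:
  assumes "finite X" "finite Y"
  shows "card (X <#>\<^bsub>G\<^esub> Y) \<le> card X * card Y"
proof -
  have "X <#>\<^bsub>G\<^esub> Y = (\<lambda>(a, b). a \<otimes>\<^bsub>G\<^esub> b) ` (X \<times> Y)"
    by (auto simp: set_mult_def)
  then have "card (X <#>\<^bsub>G\<^esub> Y) \<le> card (X \<times> Y)"
    using assms by (metis card_image_le finite_cartesian_product)
  then show ?thesis by (simp add: card_cartesian_product)
qed

lemma finite_set_prod: "(\<And>X. X \<in> set Xs \<Longrightarrow> finite X) \<Longrightarrow> finite (set_prod G Xs)"
  by (induction Xs) (simp_all add: finite_set_mult)

lemma mem_set_prod: "x \<in> set_prod G Xs \<longleftrightarrow> (\<exists>xs. list_all2 (\<in>) xs Xs \<and> x = lprod G xs)"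
proof (induction Xs arbitrary: x)
  case (Cons X Xs)
  then show ?case by (fastforce simp: mem_set_mult list_all2_Cons2)
qed simp

lemma list_all2_replicate: "list_all2 (\<in>) xs (replicate n T) \<longleftrightarrow> set xs \<subseteq> T \<and> length xs = n"
  by (auto simp: list_all2_conv_all_nth in_set_conv_nth set_conv_nth)

lemma mem_set_power:
  "x \<in> set_power G T n \<longleftrightarrow> (\<exists>xs. set xs \<subseteq> T \<and> length xs = n \<and> x = lprod G xs)"
  by (auto simp: mem_set_prod list_all2_replicate)

lemma set_power_mono_set: "S \<subseteq> T \<Longrightarrow> set_power G S n \<subseteq> set_power G T n"
  by (fastforce simp: mem_set_power)

context group begin

lemma lprod_closed [simp, intro]: "set xs \<subseteq> carrier G \<Longrightarrow> lprod G xs \<in> carrier G"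
  by (induction xs) auto

lemma lprod_append:
  "set xs \<subseteq> carrier G \<Longrightarrow> set ys \<subseteq> carrier G \<Longrightarrow> lprod G (xs @ ys) = lprod G xs \<otimes> lprod G ys"
  by (induction xs) (simp_all add: m_assoc)

end

text \<open>\<open>set_prod\<close> is typed for \<open>'a monoid\<close> without record extensions,
  while \<open>group\<close> admits extensions; this locale fixes the type so that both apply to the
  same \<open>G\<close>.\<close>

locale monoid_group = group G for G :: "'a monoid" (structure)
begin

lemma set_prod_closed: "(\<And>X. X \<in> set Xs \<Longrightarrow> X \<subseteq> carrier G) \<Longrightarrow> set_prod G Xs \<subseteq> carrier G"
  by (induction Xs) (auto simp: set_mult_def)

lemma set_prod_append:
  assumes "\<And>X. X \<in> set Xs \<union> set Ys \<Longrightarrow> X \<subseteq> carrier G"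
  shows "set_prod G (Xs @ Ys) = set_prod G Xs <#> set_prod G Ys"
  using assms
proof (induction Xs)
  case Nil
  then have "set_prod G Ys \<subseteq> carrier G"
    by (intro set_prod_closed) auto
  then show ?case by (force simp: set_mult_def)
next
  case (Cons X Xs)
  have "set_prod G Ys \<subseteq> carrier G" "set_prod G Xs \<subseteq> carrier G" "X \<subseteq> carrier G"
    using Cons.prems by (auto intro!: set_prod_closed)
  then show ?case using Cons by (simp add: set_mult_assoc)
qed

context
  fixes T :: "'a set"
  assumes T_closed: "T \<subseteq> carrier G"
begin

lemma set_power_closed: "set_power G T n \<subseteq> carrier G"
  using T_closed by (intro set_prod_closed) auto

lemma set_power_mult:
  "x \<in> set_power G T m \<Longrightarrow> y \<in> set_power G T n \<Longrightarrow> x \<otimes> y \<in> set_power G T (m + n)"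
  using T_closed by (subst replicate_add, subst set_prod_append) (auto simp: mem_set_mult)

lemma set_power_mono:
  assumes "\<one> \<in> T" "m \<le> n" "x \<in> set_power G T m"
  shows "x \<in> set_power G T n"
proof -
  have "\<one> \<in> set_power G T k" for k
    by (induction k) (use assms(1) in \<open>auto simp: mem_set_mult intro!: bexI[of _ \<one>]\<close>)
  from set_power_mult[OF assms(3) this[of "n - m"]] show ?thesis
    using assms set_power_closed by (auto simp: subset_iff)
qed

lemma set_power_one: "x \<in> T \<Longrightarrow> x \<in> set_power G T (Suc 0)"
  using T_closed by (auto simp: mem_set_mult intro!: bexI[of _ x])

lemma set_power_inv:
  assumes "\<And>t. t \<in> T \<Longrightarrow> inv t \<in> T" "x \<in> set_power G T n"
  shows "inv x \<in> set_power G T n"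
  using assms(2)
proof (induction n arbitrary: x)
  case (Suc n)
  then obtain t y where ty: "t \<in> T" "y \<in> set_power G T n" "x = t \<otimes> y"
    by (auto simp: mem_set_mult)
  then have "inv x = inv y \<otimes> inv t"
    using T_closed set_power_closed by (auto intro!: inv_mult_group)
  then show ?case
    using set_power_mult[OF Suc.IH[OF ty(2)] set_power_one[OF assms(1)[OF ty(1)]]] by simp
qed simp

lemma set_power_power:
  assumes "\<And>s. s \<in> S \<Longrightarrow> s \<in> set_power G T k" "x \<in> set_power G S n"
  shows "x \<in> set_power G T (n * k)"
  using assms(2)
proof (induction n arbitrary: x)
  case (Suc n)
  then show ?case using assms(1) by (auto simp: mem_set_mult intro!: set_power_mult)
qed simp

text \<open>Conjugation by \<open>g\<close> is multiplicative, so the costs of the single letters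
  add up.\<close>

lemma conj_set_power:
  assumes g: "g \<in> carrier G"
    and "\<And>s. s \<in> T \<Longrightarrow> \<exists>t\<in>set_power G T c. g \<otimes> s = t \<otimes> g"
    and "x \<in> set_power G T k"
  shows "\<exists>t\<in>set_power G T (k * c). g \<otimes> x = t \<otimes> g"
  using assms(3)
proof (induction k arbitrary: x)
  case 0
  then show ?case using g by simp
next
  case (Suc k)
  then obtain s y where sy: "s \<in> T" "y \<in> set_power G T k" "x = s \<otimes> y"
    by (auto simp: mem_set_mult)
  obtain t where t: "t \<in> set_power G T c" "g \<otimes> s = t \<otimes> g" using assms(2) sy by blast
  obtain u where u: "u \<in> set_power G T (k * c)" "g \<otimes> y = u \<otimes> g" using Suc.IH sy by blast
  have cl: "s \<in> carrier G" "y \<in> carrier G" "t \<in> carrier G" "u \<in> carrier G"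
    using sy t u T_closed set_power_closed by auto
  have "g \<otimes> x = (g \<otimes> s) \<otimes> y" using sy cl g by (simp add: m_assoc)
  also have "\<dots> = t \<otimes> (g \<otimes> y)" using t cl g by (simp add: m_assoc)
  also have "\<dots> = (t \<otimes> u) \<otimes> g" using u cl g by (simp add: m_assoc)
  finally show ?case using set_power_mult[OF t(1) u(1)] by auto
qed

end

text \<open>Conjugating a letter of rank \<open>w\<close> produces one letter of rank \<open>w\<close> and boundedly many of
  smaller rank; hence iterated conjugation only grows polynomially, with degree the rank.\<close>

lemma iterated_conj:
  fixes U :: "nat \<Rightarrow> 'a set"
  assumes U0: "U 0 = {\<one>}"
    and U_closed: "\<And>w. U w \<subseteq> carrier G" and U_one: "\<And>w. \<one> \<in> U w"
    and U_mono: "\<And>w. U w \<subseteq> U (Suc w)"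
    and B_closed: "B \<subseteq> carrier G"
    and conj: "\<And>g s w. \<lbrakk>g \<in> B; w < W; s \<in> U (Suc w)\<rbrakk> \<Longrightarrow>
      \<exists>t\<in>set_power G (U w) D. \<exists>s'\<in>U (Suc w). \<exists>t'\<in>set_power G (U w) D.
        g \<otimes> s = t \<otimes> s' \<otimes> t' \<otimes> g"
    and "w \<le> W" "set gs \<subseteq> B" "s \<in> U w"
  shows "\<exists>t\<in>set_power G (U w) ((1 + 2 * D * length gs) ^ w). lprod G gs \<otimes> s = t \<otimes> lprod G gs"
  using assms(7-9)
proof (induction w arbitrary: gs s)
  case 0
  then show ?case using U0 B_closed by (auto simp: mem_set_mult)
next
  case (Suc w)
  \<comment> \<open>The inner induction removes the letter of \<open>gs\<close> next to
    \<open>s\<close>, which acts first. The outer hypothesis, applied to all remaining letters of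
    \<open>gs\<close> at once, handles the smaller letters in \<open>t\<close> and
    \<open>t'\<close>; the inner one handles \<open>s'\<close>.\<close>
  from Suc.prems(2,3) show ?case
  proof (induction gs arbitrary: s rule: rev_induct)
    case Nil
    then have "s \<in> carrier G" using U_closed[of "Suc w"] by blast
    with Nil show ?case by (auto simp: mem_set_mult intro!: bexI[of _ s])
  next
    case (snoc g gs)
    let ?h = "lprod G gs" and ?m = "length gs"
    let ?P = "\<lambda>k. set_power G (U (Suc w)) k" and ?c = "(1 + 2 * D * ?m) ^ w"
    note cU = U_closed[of "Suc w"]
    have g: "g \<in> B" "g \<in> carrier G" and gs: "set gs \<subseteq> B" "set gs \<subseteq> carrier G"
      using snoc.prems B_closed by auto
    then have h: "?h \<in> carrier G" by simp
    obtain t s' t' where *: "t \<in> set_power G (U w) D" "s' \<in> U (Suc w)" "t' \<in> set_power G (U w) D"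
      "g \<otimes> s = t \<otimes> s' \<otimes> t' \<otimes> g"
      using conj[OF g(1) Suc_le_lessD[OF Suc.prems(1)] snoc.prems(2)] by (elim bexE)
    have low: "\<exists>v\<in>?P (D * ?c). ?h \<otimes> u = v \<otimes> ?h" if u: "u \<in> set_power G (U w) D" for u
    proof -
      obtain v where "v \<in> set_power G (U w) (D * ?c)" "?h \<otimes> u = v \<otimes> ?h"
        using conj_set_power[OF U_closed h Suc.IH[OF Suc_leD[OF Suc.prems(1)] gs(1)] u] by blast
      then show ?thesis using set_power_mono_set[OF U_mono[of w]] by blast
    qed
    obtain v where v: "v \<in> ?P (D * ?c)" "?h \<otimes> t = v \<otimes> ?h" using low *(1) by blast
    obtain v' where v': "v' \<in> ?P (D * ?c)" "?h \<otimes> t' = v' \<otimes> ?h" using low *(3) by blast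
    obtain v'' where v'': "v'' \<in> ?P ((1 + 2 * D * ?m) ^ Suc w)" "?h \<otimes> s' = v'' \<otimes> ?h"
      using snoc.IH[OF gs(1) *(2)] by blast
    have cl: "s \<in> carrier G" "t \<in> carrier G" "t' \<in> carrier G" "s' \<in> carrier G"
      "v \<in> carrier G" "v' \<in> carrier G" "v'' \<in> carrier G"
      using * v(1) v'(1) v''(1) snoc.prems(2) cU U_closed[of w] set_power_closed[OF cU]
        set_power_closed[OF U_closed[of w]] by blast+
    have "lprod G (gs @ [g]) \<otimes> s = ?h \<otimes> (g \<otimes> s)"
      using g h gs cl by (simp add: lprod_append m_assoc)
    also have "\<dots> = (?h \<otimes> t) \<otimes> s' \<otimes> t' \<otimes> g" using *(4) g h cl by (simp add: m_assoc)
    also have "\<dots> = v \<otimes> (?h \<otimes> s') \<otimes> t' \<otimes> g" using v(2) g h cl by (simp add: m_assoc)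
    also have "\<dots> = v \<otimes> v'' \<otimes> (?h \<otimes> t') \<otimes> g" using v''(2) g h cl by (simp add: m_assoc)
    also have "\<dots> = v \<otimes> v'' \<otimes> v' \<otimes> lprod G (gs @ [g])"
      using v'(2) g h gs cl by (simp add: lprod_append m_assoc)
    finally have eq: "lprod G (gs @ [g]) \<otimes> s = v \<otimes> v'' \<otimes> v' \<otimes> lprod G (gs @ [g])" .
    have mem: "v \<otimes> v'' \<otimes> v' \<in> ?P (D * ?c + (1 + 2 * D * ?m) ^ Suc w + D * ?c)"
      using v(1) v'(1) v''(1) by (intro set_power_mult cU)
    \<comment> \<open>\<open>?c\<close> is the cost of one smaller letter. Since
      \<open>(1 + 2 * D * ?m) ^ Suc w\<close> equals \<open>(1 + 2 * D * ?m) * ?c\<close>, the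
      \<open>2 * D\<close> smaller letters just raise the coefficient from \<open>?m\<close> to
      \<open>Suc ?m\<close>.\<close>
    have "D * ?c + (1 + 2 * D * ?m) ^ Suc w + D * ?c = (1 + 2 * D * Suc ?m) * ?c"
      by (simp add: algebra_simps)
    also have "\<dots> \<le> (1 + 2 * D * Suc ?m) * (1 + 2 * D * Suc ?m) ^ w"
      by (intro mult_left_mono power_mono) auto
    finally have "v \<otimes> v'' \<otimes> v' \<in> ?P ((1 + 2 * D * length (gs @ [g])) ^ Suc w)"
      using set_power_mono[OF cU U_one _ mem] by simp
    then show ?case using eq by blast
  qed
qed

end

section \<open>Words over one abelian layer\<close>

lemma set_multI: "x \<in> X \<Longrightarrow> y \<in> Y \<Longrightarrow> x \<otimes>\<^bsub>G\<^esub> y \<in> X <#>\<^bsub>G\<^esub> Y"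
  by (auto simp: set_mult_def)

text \<open>A multiset over \<open>E\<close> is determined by its multiplicities on
  \<open>E\<close>, each of them at most \<open>n\<close>. Counting overflow letters with
  multiplicity instead of in order is what keeps the number of translates polynomial in
  \<open>n\<close>.\<close>

lemma multisets_bounded:
  assumes "finite E"
  shows "finite {m. set_mset m \<subseteq> E \<and> size m \<le> n}"
    and "card {m. set_mset m \<subseteq> E \<and> size m \<le> n} \<le> (n + 1) ^ card E"
proof -
  let ?M = "{m. set_mset m \<subseteq> E \<and> size m \<le> n}"
  let ?f = "\<lambda>m. restrict (count m) E"
  have inj: "inj_on ?f ?M"
  proof (rule inj_onI, rule multiset_eqI)
    fix m m' x assume m: "m \<in> ?M" "m' \<in> ?M" "?f m = ?f m'"
    show "count m x = count m' x"
    proof (cases "x \<in> E")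
      case True
      then show ?thesis using fun_cong[OF m(3), of x] by simp
    next
      case False
      then have "x \<notin># m" "x \<notin># m'" using m by auto
      then show ?thesis by (simp add: not_in_iff)
    qed
  qed
  have sub: "?f ` ?M \<subseteq> (\<Pi>\<^sub>E x\<in>E. {0..n})"
    by (auto intro: order_trans[OF count_le_size])
  have fin: "finite (\<Pi>\<^sub>E x\<in>E. {0..n})" using assms by (intro finite_PiE) auto
  show "finite ?M" using finite_imageD[OF finite_subset[OF sub fin] inj] .
  have "card ?M = card (?f ` ?M)" using inj by (simp add: card_image)
  also have "\<dots> \<le> card (\<Pi>\<^sub>E x\<in>E. {0..n})" using sub fin by (rule card_mono[rotated])
  also have "\<dots> = (n + 1) ^ card E" using assms by (simp add: card_PiE)
  finally show "card ?M \<le> (n + 1) ^ card E" .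
qed

section \<open>Equality up to a short word on the left\<close>

text \<open>In the application \<open>T\<close> consists of the letters of the later layers and
  their inverses, and \<open>B\<close> of the letters of one layer. \<open>c m\<close> bounds the
  length of the word that arises when a letter of \<open>T\<close> passes \<open>m\<close> letters
  of \<open>B\<close>.\<close>

locale layer = monoid_group G for G :: "'a monoid" (structure) +
  fixes T B :: "'a set" and c :: "nat \<Rightarrow> nat"
  assumes T_closed: "T \<subseteq> carrier G" and one_T: "\<one> \<in> T" and inv_T: "t \<in> T \<Longrightarrow> inv t \<in> T"
    and B_closed: "B \<subseteq> carrier G" and mono_c: "mono c"
    and conj: "\<lbrakk>set gs \<subseteq> B; s \<in> T\<rbrakk> \<Longrightarrow>
      \<exists>t\<in>set_power G T (c (length gs)). lprod G gs \<otimes> s = t \<otimes> lprod G gs"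
begin

text \<open>Errors are collected at the left end. Multiplication on the right is then free, whereas
  a word in \<open>B\<close> multiplied on the left has to be passed by the error, whose length is
  thereby multiplied by a value of \<open>c\<close>. This asymmetry governs the direction of the
  inductions below.\<close>

definition near :: "nat \<Rightarrow> 'a \<Rightarrow> 'a \<Rightarrow> bool" where
  "near k x y \<longleftrightarrow> (\<exists>t\<in>set_power G T k. x = t \<otimes> y)"

lemma power_closed [simp]: "t \<in> set_power G T k \<Longrightarrow> t \<in> carrier G"
  using set_power_closed[OF T_closed] by auto

lemma B_list_closed: "set us \<subseteq> B \<Longrightarrow> set us \<subseteq> carrier G"
  using B_closed by blast

lemma near_refl: "x \<in> carrier G \<Longrightarrow> near 0 x x"
  by (simp add: near_def)

lemma near_trans:
  assumes "near k x y" "near k' y z" "z \<in> carrier G"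
  shows "near (k + k') x z"
proof -
  obtain t t' where "t \<in> set_power G T k" "x = t \<otimes> y" "t' \<in> set_power G T k'" "y = t' \<otimes> z"
    using assms by (auto simp: near_def)
  then show ?thesis unfolding near_def
    using set_power_mult[OF T_closed] assms(3) by (intro bexI[of _ "t \<otimes> t'"]) (auto simp: m_assoc)
qed

lemma near_mono: "near k x y \<Longrightarrow> k \<le> k' \<Longrightarrow> near k' x y"
  using set_power_mono[OF T_closed one_T] by (auto simp: near_def)

lemma near_sym:
  assumes "near k x y" "y \<in> carrier G"
  shows "near k y x"
proof -
  obtain t where "t \<in> set_power G T k" "x = t \<otimes> y" using assms by (auto simp: near_def)
  then show ?thesis unfolding near_def
    using set_power_inv[OF T_closed inv_T] assms(2)
    by (intro bexI[of _ "inv t"]) (auto simp: m_assoc[symmetric])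
qed

lemma near_right:
  assumes "near k x y" "y \<in> carrier G" "z \<in> carrier G"
  shows "near k (x \<otimes> z) (y \<otimes> z)"
  using assms by (auto simp: near_def m_assoc)

lemma near_left:
  assumes us: "set us \<subseteq> B" "length us \<le> M" and "near k x y" "y \<in> carrier G"
  shows "near (k * c M) (lprod G us \<otimes> x) (lprod G us \<otimes> y)"
proof -
  have cl: "lprod G us \<in> carrier G" using B_list_closed[OF us(1)] by simp
  obtain t where t: "t \<in> set_power G T k" "x = t \<otimes> y" using assms by (auto simp: near_def)
  have "\<exists>t\<in>set_power G T (c M). lprod G us \<otimes> s = t \<otimes> lprod G us" if "s \<in> T" for s
    using conj[OF us(1) that] set_power_mono[OF T_closed one_T monoD[OF mono_c us(2)]] by blast
  from conj_set_power[OF T_closed cl this t(1)]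
  obtain u where u: "u \<in> set_power G T (k * c M)" "lprod G us \<otimes> t = u \<otimes> lprod G us" by blast
  have "lprod G us \<otimes> x = (lprod G us \<otimes> t) \<otimes> y"
    using t cl assms(4) by (simp add: m_assoc)
  also have "\<dots> = u \<otimes> (lprod G us \<otimes> y)"
    using u cl assms(4) by (simp add: m_assoc)
  finally show ?thesis using u(1) by (auto simp: near_def)
qed

lemma near_insert:
  assumes "set us \<subseteq> B" "length us \<le> M" "near k x y" "y \<in> carrier G" "z \<in> carrier G"
    "x \<in> carrier G"
  shows "near (k * c M) (lprod G us \<otimes> (x \<otimes> z)) (lprod G us \<otimes> (y \<otimes> z))"
  using assms by (intro near_left near_right) auto

end

section \<open>Rearranging words in one layer\<close>

locale commuting_layer = layer +
  fixes D :: nat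
  assumes comm: "\<lbrakk>x \<in> B; y \<in> B\<rbrakk> \<Longrightarrow> near D (x \<otimes> y) (y \<otimes> x)"
begin

text \<open>\<open>x\<close> passes the last letter of \<open>us\<close> first. The error arises
  behind a prefix of \<open>us\<close> and is carried to the far left at once, so every exchange
  costs \<open>D * c M\<close> and no earlier error is amplified.\<close>

lemma near_swap:
  assumes "set us \<subseteq> B" "length us \<le> M" "x \<in> B"
  shows "near (length us * (D * c M)) (lprod G us \<otimes> x) (x \<otimes> lprod G us)"
  using assms(1,2)
proof (induction us rule: rev_induct)
  case Nil
  then show ?case using assms(3) B_closed near_refl by auto
next
  case (snoc a us)
  have cl: "set us \<subseteq> carrier G" "a \<in> carrier G" "x \<in> carrier G" "set us \<subseteq> B" "a \<in> B"
    using snoc.prems assms(3) B_closed by auto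
  have "near (D * c M) (lprod G us \<otimes> (a \<otimes> x)) (lprod G us \<otimes> (x \<otimes> a))"
    using snoc.prems cl assms(3) by (intro near_left comm) auto
  moreover have "near (length us * (D * c M)) (lprod G us \<otimes> x \<otimes> a) (x \<otimes> lprod G us \<otimes> a)"
    using snoc cl by (intro near_right snoc.IH) auto
  ultimately have "near (D * c M + length us * (D * c M))
      (lprod G us \<otimes> (a \<otimes> x)) (x \<otimes> lprod G us \<otimes> a)"
    using cl by (intro near_trans) (auto simp: m_assoc)
  then show ?case using cl by (simp add: lprod_append m_assoc)
qed

text \<open>At most \<open>M\<close> letters are put in place. Each passes at most \<open>M\<close>
  others at cost \<open>D * c M\<close>, and the last factor \<open>c M\<close> pays for carrying
  the resulting error over the prefix in front of them.\<close>

definition perm_cost :: "nat \<Rightarrow> nat" where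
  "perm_cost M = M * (M * D * c M * c M)"

text \<open>The induction peels letters off the right end: peeling from the left would conjugate
  the error accumulated so far at every step, which makes it grow exponentially.\<close>

lemma near_perm:
  assumes "mset us = mset vs" "set us \<subseteq> B" "length us \<le> M"
  shows "near (perm_cost M) (lprod G us) (lprod G vs)"
proof -
  have "near (length us * (M * D * c M * c M)) (lprod G us) (lprod G vs)"
    using assms
  proof (induction us arbitrary: vs rule: rev_induct)
    case Nil
    then show ?case using near_refl by simp
  next
    case (snoc x us)
    then have "x \<in> set vs" by (metis in_set_conv_decomp set_mset_mset)
    then obtain v w where vs: "vs = v @ x # w" by (auto simp: in_set_conv_decomp)
    have ms: "mset us = mset (v @ w)" using snoc.prems(1) vs by simp
    have "set us = set (v @ w)" "length us = length (v @ w)"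
      using ms by (metis set_mset_mset, metis size_mset)
    then have B: "set us \<subseteq> B" "set v \<subseteq> B" "set w \<subseteq> B" "x \<in> B"
      and len: "length us \<le> M" "length v \<le> M" "length w \<le> M"
      using snoc.prems by auto
    note cl = B(1-3)[THEN B_list_closed] subsetD[OF B_closed B(4)]
    have "near (length us * (M * D * c M * c M)) (lprod G us \<otimes> x) (lprod G (v @ w) \<otimes> x)"
      using ms B len cl by (intro near_right snoc.IH) auto
    \<comment> \<open>The letter \<open>x\<close> moves from the right end over \<open>w\<close> to
      its place in \<open>vs\<close>; the error is then carried over \<open>v\<close>.\<close>
    moreover have "near (length w * (D * c M) * c M)
        (lprod G v \<otimes> (lprod G w \<otimes> x)) (lprod G v \<otimes> (x \<otimes> lprod G w))"
      using B len cl by (intro near_left near_swap) auto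
    ultimately have "near (length us * (M * D * c M * c M) + length w * (D * c M) * c M)
        (lprod G us \<otimes> x) (lprod G v \<otimes> (x \<otimes> lprod G w))"
      using cl by (intro near_trans) (auto simp: lprod_append m_assoc)
    moreover have "length us * (M * D * c M * c M) + length w * (D * c M) * c M
        \<le> length (us @ [x]) * (M * D * c M * c M)"
      using mult_right_mono[OF len(3), of "D * c M * c M"] by (simp add: algebra_simps)
    ultimately show ?case
      using cl unfolding vs by (auto simp: lprod_append intro: near_mono)
  qed
  then show ?thesis
    unfolding perm_cost_def by (rule near_mono) (use assms(3) in simp)
qed

end

section \<open>Normal forms with overflow letters\<close>

text \<open>A product of two letters of kind \<open>j\<close> need not be near a letter of that
  kind, but is near one multiplied by an overflow letter from \<open>Es j\<close>. The number of
  these is bounded independently of the lengths of the intervals, hence the exponent in the final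
  count is too.\<close>

locale abelian_layer = commuting_layer +
  fixes r :: nat and Bs Es :: "nat \<Rightarrow> 'a set"
  assumes B_eq: "B = (\<Union>j\<le>r. Bs j)" and one_Bs: "j \<le> r \<Longrightarrow> \<one> \<in> Bs j"
    and Es_subset: "j \<le> r \<Longrightarrow> Es j \<subseteq> Bs j"
    and finite_Es: "j \<le> r \<Longrightarrow> finite (Es j)" and card_Es: "j \<le> r \<Longrightarrow> card (Es j) \<le> 3"
    and mult: "\<lbrakk>j \<le> r; x \<in> Bs j; y \<in> Bs j\<rbrakk> \<Longrightarrow> \<exists>e\<in>Es j. \<exists>b\<in>Bs j. near D (x \<otimes> y) (e \<otimes> b)"
    and inverse: "\<lbrakk>j \<le> r; x \<in> Bs j\<rbrakk> \<Longrightarrow> \<exists>b\<in>Bs j. near D (inv x) b"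
begin

definition E :: "'a set" where "E = (\<Union>j\<le>r. Es j)"

text \<open>The value of such a list lies in the product of \<open>Bs 0\<close> up to
  \<open>Bs r\<close>, which is \<open>A\<^sub>i\<close> in the application.\<close>

definition normal_form :: "'a list \<Rightarrow> bool" where
  "normal_form bs \<longleftrightarrow> length bs = Suc r \<and> (\<forall>j\<le>r. bs ! j \<in> Bs j)"

text \<open>Covers every kind of appended letter: two rearrangements and one merge for a letter of
  \<open>B\<close>, a further \<open>D * c M\<close> to replace an inverse by a letter, and
  \<open>c M\<close> for a letter of \<open>T\<close>.\<close>

definition step_cost :: "nat \<Rightarrow> nat" where
  "step_cost M = 2 * perm_cost M + 2 * (D * c M) + c M"

lemma E_subset: "E \<subseteq> B"
  using Es_subset by (auto simp: E_def B_eq)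

lemma finite_E: "finite E"
  using finite_Es by (simp add: E_def)

lemma card_E: "card E \<le> 3 * Suc r"
proof -
  have "card E \<le> (\<Sum>j\<le>r. card (Es j))" unfolding E_def by (rule card_UN_le) simp
  also have "\<dots> \<le> (\<Sum>j\<le>r. 3)" by (intro sum_mono card_Es) simp
  finally show ?thesis by simp
qed

lemma normal_B: "normal_form bs \<Longrightarrow> set bs \<subseteq> B"
  by (fastforce simp: normal_form_def B_eq in_set_conv_nth less_Suc_eq_le)

text \<open>Only the entry of \<open>bs\<close> of the same kind as \<open>x\<close> changes:
  \<open>x\<close> is brought next to it, the two are merged into \<open>e\<close> and
  \<open>b\<close>, and \<open>e\<close> joins the overflow letters in front. Both moves are
  permutations, whence twice \<open>perm_cost M\<close>.\<close>

lemma near_append_B: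
  assumes es: "set es \<subseteq> E" and bs: "normal_form bs" and len: "length es + r + 3 \<le> M" and x: "x \<in> B"
  shows "\<exists>e bs'. e \<in> E \<and> normal_form bs' \<and> near (2 * perm_cost M + D * c M)
    (lprod G (es @ bs) \<otimes> x) (lprod G (es @ [e] @ bs'))"
proof -
  obtain j where j: "j \<le> r" "x \<in> Bs j" using x by (auto simp: B_eq)
  have bj: "bs ! j \<in> Bs j" and lbs: "length bs = Suc r" using bs j by (auto simp: normal_form_def)
  obtain e b where eb: "e \<in> Es j" "b \<in> Bs j" "near D (bs ! j \<otimes> x) (e \<otimes> b)"
    using mult[OF j(1) bj j(2)] by blast
  define tk where "tk = take j bs"
  define dr where "dr = drop (Suc j) bs"
  have bs_eq: "bs = tk @ bs ! j # dr"
    using id_take_nth_drop[of j bs] j lbs by (simp add: tk_def dr_def)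
  have new: "normal_form (tk @ b # dr)"
  proof -
    have "tk @ b # dr = bs[j := b]"
      using upd_conv_take_nth_drop[of j bs b] j lbs by (simp add: tk_def dr_def)
    then show ?thesis using bs eb(2) j by (auto simp: normal_form_def nth_list_update)
  qed
  have B: "set es \<subseteq> B" "set tk \<subseteq> B" "set dr \<subseteq> B" "bs ! j \<in> B" "e \<in> B" "b \<in> B"
    using es E_subset normal_B[OF new] bj eb j Es_subset[OF j(1)] by (auto simp: B_eq)
  note cl = B(1-3)[THEN B_list_closed] B(4-6)[THEN subsetD[OF B_closed]] subsetD[OF B_closed x]
  have mset_bs: "mset bs = mset (tk @ bs ! j # dr)"
    using bs_eq by (rule arg_cong)
  have "length bs = length (tk @ bs ! j # dr)"
    using bs_eq by (rule arg_cong)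
  then have ltd: "length tk + length dr = r" using lbs by simp
  have 1: "near (perm_cost M) (lprod G (es @ bs @ [x])) (lprod G ((es @ tk) @ [bs ! j, x] @ dr))"
    using B x lbs len normal_B[OF bs] mset_bs by (intro near_perm) auto
  have "near (D * c M) (lprod G (es @ tk) \<otimes> ((bs ! j \<otimes> x) \<otimes> lprod G dr))
      (lprod G (es @ tk) \<otimes> ((e \<otimes> b) \<otimes> lprod G dr))"
    using B x ltd len cl eb(3) by (intro near_insert) auto
  then have 2: "near (D * c M) (lprod G ((es @ tk) @ [bs ! j, x] @ dr))
      (lprod G ((es @ tk) @ [e, b] @ dr))"
    using cl by (simp add: lprod_append m_assoc)
  have 3: "near (perm_cost M) (lprod G ((es @ tk) @ [e, b] @ dr)) (lprod G (es @ [e] @ tk @ b # dr))"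
    using B ltd len by (intro near_perm) auto
  have "near (perm_cost M + D * c M + perm_cost M)
      (lprod G (es @ bs @ [x])) (lprod G (es @ [e] @ tk @ b # dr))"
    using cl by (intro near_trans[OF near_trans[OF 1 2] 3] lprod_closed) auto
  moreover have "lprod G (es @ bs @ [x]) = lprod G (es @ bs) \<otimes> x"
    using cl normal_B[OF bs] B_closed by (simp add: lprod_append m_assoc)
  ultimately show ?thesis
    using eb(1) j new by (intro exI[of _ e] exI[of _ "tk @ b # dr"]) (auto simp: E_def mult_2 add_ac)
qed

lemma near_append:
  assumes es: "set es \<subseteq> E" and bs: "normal_form bs" and len: "length es + r + 3 \<le> M"
    and x: "x \<in> T \<union> B \<union> m_inv G ` B"
  shows "\<exists>es' bs'. set es' \<subseteq> E \<and> length es' \<le> Suc (length es) \<and> normal_form bs' \<and>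
    near (step_cost M) (lprod G (es @ bs) \<otimes> x) (lprod G (es' @ bs'))"
proof -
  have lbs: "length bs = Suc r" using bs by (simp add: normal_form_def)
  have eb: "set (es @ bs) \<subseteq> B" "length (es @ bs) \<le> M" "set es \<subseteq> B"
    using es bs normal_B E_subset len lbs by auto
  note cl = B_list_closed[OF eb(1)]
  consider "x \<in> T" | "x \<in> B" | y where "y \<in> B" "x = inv y" using x by blast
  then show ?thesis
  proof cases
    case 1
    \<comment> \<open>A letter of \<open>T\<close> is itself an error; it is carried to the left
      over the whole word.\<close>
    then have "near 1 x \<one>"
      using T_closed set_power_one[OF T_closed 1] by (auto simp: near_def simp del: set_prod_Cons intro!: bexI[of _ x])
    then have "near (1 * c M) (lprod G (es @ bs) \<otimes> x) (lprod G (es @ bs) \<otimes> \<one>)"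
      using eb by (intro near_left) auto
    then have "near (step_cost M) (lprod G (es @ bs) \<otimes> x) (lprod G (es @ bs))"
      using cl by (auto simp: step_cost_def intro: near_mono)
    then show ?thesis using es bs by (intro exI[of _ es] exI[of _ bs]) auto
  next
    case 2
    from near_append_B[OF es bs len 2]
    obtain e bs' where "e \<in> E" "normal_form bs'"
      "near (2 * perm_cost M + D * c M) (lprod G (es @ bs) \<otimes> x) (lprod G (es @ [e] @ bs'))"
      by blast
    then show ?thesis using es
      by (intro exI[of _ "es @ [e]"] exI[of _ bs'])
        (auto simp: step_cost_def intro: near_mono)
  next
    case 3
    then obtain j where j: "j \<le> r" "y \<in> Bs j" by (auto simp: B_eq)
    then obtain b where b: "b \<in> Bs j" "near D x b" using inverse 3 by blast
    then have bB: "b \<in> B" using j by (auto simp: B_eq)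
    then have bc: "b \<in> carrier G" using B_closed by blast
    from near_append_B[OF es bs len bB]
    obtain e bs' where *: "e \<in> E" "normal_form bs'"
      "near (2 * perm_cost M + D * c M) (lprod G (es @ bs) \<otimes> b) (lprod G (es @ [e] @ bs'))"
      by blast
    have "near (D * c M) (lprod G (es @ bs) \<otimes> x) (lprod G (es @ bs) \<otimes> b)"
      using eb b bc by (intro near_left) auto
    then have "near (D * c M + (2 * perm_cost M + D * c M))
        (lprod G (es @ bs) \<otimes> x) (lprod G (es @ [e] @ bs'))"
      using eb(3) *(1) normal_B[OF *(2)] E_subset B_closed
      by (intro near_trans[OF _ *(3)] lprod_closed) auto
    then show ?thesis using * es
      by (intro exI[of _ "es @ [e]"] exI[of _ bs'])
        (auto simp: step_cost_def intro: near_mono)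
  qed
qed

text \<open>Letters are appended on the right, where \<open>near\<close> is preserved for free, so
  the errors add up linearly in the length of the word.\<close>

lemma near_normal_form:
  assumes "set xs \<subseteq> T \<union> B \<union> m_inv G ` B" "length xs + r + 3 \<le> M"
  shows "\<exists>es bs. set es \<subseteq> E \<and> length es \<le> length xs \<and> normal_form bs \<and>
    near (length xs * step_cost M) (lprod G xs) (lprod G (es @ bs))"
  using assms
proof (induction xs rule: rev_induct)
  case Nil
  have "lprod G (replicate n \<one>) = \<one>" for n by (induction n) auto
  then show ?case using one_Bs near_refl
    by (intro exI[of _ "[]"] exI[of _ "replicate (Suc r) \<one>"]) (auto simp: normal_form_def simp del: replicate_Suc)
next
  case (snoc x xs)
  then obtain es bs where *: "set es \<subseteq> E" "length es \<le> length xs" "normal_form bs"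
    "near (length xs * step_cost M) (lprod G xs) (lprod G (es @ bs))"
    by auto
  obtain es' bs' where **: "set es' \<subseteq> E" "length es' \<le> Suc (length es)" "normal_form bs'"
    "near (step_cost M) (lprod G (es @ bs) \<otimes> x) (lprod G (es' @ bs'))"
    using near_append[OF *(1,3), of M x] *(2) snoc.prems by auto
  have sub: "T \<union> B \<union> m_inv G ` B \<subseteq> carrier G" using T_closed B_closed by auto
  then have cl: "set xs \<subseteq> carrier G" "x \<in> carrier G" using snoc.prems by auto
  have cl': "set (es @ bs) \<subseteq> carrier G" "set (es' @ bs') \<subseteq> carrier G"
    using *(1) **(1) normal_B[OF *(3)] normal_B[OF **(3)] E_subset B_closed by auto
  have "near (length xs * step_cost M + step_cost M) (lprod G xs \<otimes> x) (lprod G (es' @ bs'))"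
    using cl cl' by (intro near_trans[OF near_right[OF *(4)] **(4)] lprod_closed) auto
  then show ?case using ** *(2) cl
    by (intro exI[of _ es'] exI[of _ bs']) (auto simp: lprod_append add.commute)
qed

text \<open>\<open>near_left\<close> applies to words in \<open>B\<close> only, not to their
  inverses. So the inverse of a word is replaced by a word in \<open>B\<close> that cancels it up to
  an error, built from letters near the inverses of the single letters.\<close>

lemma near_cancel:
  obtains \<nu> where "\<And>e. e \<in> B \<Longrightarrow> \<nu> e \<in> B"
    "\<And>es M. \<lbrakk>set es \<subseteq> B; length es \<le> M\<rbrakk> \<Longrightarrow>
      near (length es * (D * c M)) (lprod G (rev (map \<nu> es)) \<otimes> lprod G es) \<one>"
proof -
  have "\<exists>b. b \<in> B \<and> near D (b \<otimes> e) \<one>" if eB: "e \<in> B" for e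
  proof -
    have e: "e \<in> carrier G" using eB B_closed by blast
    obtain j where j: "j \<le> r" "e \<in> Bs j" using eB by (auto simp: B_eq)
    then obtain b where b: "b \<in> Bs j" "near D (inv e) b" using inverse by blast
    then have bB: "b \<in> B" using j by (auto simp: B_eq)
    then have bc: "b \<in> carrier G" using B_closed by blast
    have "near D (b \<otimes> e) (inv e \<otimes> e)"
      using near_sym[OF b(2) bc] e by (intro near_right) auto
    then show ?thesis using e bB by auto
  qed
  then obtain \<nu> where \<nu>: "\<And>e. e \<in> B \<Longrightarrow> \<nu> e \<in> B" "\<And>e. e \<in> B \<Longrightarrow> near D (\<nu> e \<otimes> e) \<one>" by metis
  have "near (length es * (D * c M)) (lprod G (rev (map \<nu> es)) \<otimes> lprod G es) \<one>"
    if "set es \<subseteq> B" "length es \<le> M" for es M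
    using that
  proof (induction es)
    case Nil
    then show ?case using near_refl by simp
  next
    case (Cons e es)
    let ?z = "rev (map \<nu> es)"
    have B: "set ?z \<subseteq> B" "\<nu> e \<in> B" "set es \<subseteq> B" "e \<in> B" using Cons.prems \<nu>(1) by auto
    note cl = B_list_closed[OF B(1)] B_list_closed[OF B(3)] B(2,4)[THEN subsetD[OF B_closed]]
    have "near (D * c M) (lprod G ?z \<otimes> ((\<nu> e \<otimes> e) \<otimes> lprod G es)) (lprod G ?z \<otimes> (\<one> \<otimes> lprod G es))"
      using B cl \<nu>(2) Cons.prems by (intro near_insert) auto
    moreover have "lprod G ?z \<otimes> (\<one> \<otimes> lprod G es) = lprod G ?z \<otimes> lprod G es" using cl by simp
    ultimately have "near (D * c M + length es * (D * c M))
        (lprod G ?z \<otimes> ((\<nu> e \<otimes> e) \<otimes> lprod G es)) \<one>"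
      using near_trans Cons.IH Cons.prems by auto
    then show ?case using cl by (simp add: lprod_append m_assoc)
  qed
  with \<nu>(1) show ?thesis using that by blast
qed

text \<open>\<open>es\<close> is only needed up to permutation, so there are polynomially many possibilities for it;
  it is moved to the left end, so that the remainder \<open>T\<^sup>q \<cdot> B\<^sub>0 \<dots> B\<^sub>r\<close> is contiguous.\<close>

theorem cover:
  fixes n :: nat
  defines "M \<equiv> n + r + 3"
  shows "\<exists>Y. finite Y \<and> Y \<subseteq> carrier G \<and> card Y \<le> (n + 1) ^ (3 * Suc r) \<and>
    set_power G (T \<union> B \<union> m_inv G ` B) n
      \<subseteq> Y <#> (set_power G T ((n * step_cost M + perm_cost M) * c M + n * (D * c M))
             <#> set_prod G (map Bs [0..<Suc r]))"
proof -
  obtain \<nu> where \<nu>: "\<And>e. e \<in> B \<Longrightarrow> \<nu> e \<in> B"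
    "\<And>es M. \<lbrakk>set es \<subseteq> B; length es \<le> M\<rbrakk> \<Longrightarrow>
      near (length es * (D * c M)) (lprod G (rev (map \<nu> es)) \<otimes> lprod G es) \<one>"
    by (fact near_cancel)
  \<comment> \<open>One fixed arrangement of each multiset, so that the translate depends on
    multiplicities only.\<close>
  define canon :: "'a multiset \<Rightarrow> 'a list" where "canon m = (SOME us. mset us = m)" for m
  have canon: "mset (canon m) = m" for m
    unfolding canon_def by (rule someI_ex) (rule ex_mset)
  define z where "z m = rev (map \<nu> (canon m))" for m
  define MM where "MM = {m. set_mset m \<subseteq> E \<and> size m \<le> n}"
  \<comment> \<open>Multiplying \<open>w\<close> by the word \<open>z m\<close> cancels the overflow
    letters and leaves an error times a normal form; so \<open>w\<close> lies in the translate by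
    the inverse of \<open>z m\<close>.\<close>
  define Y where "Y = (\<lambda>m. inv (lprod G (z m))) ` MM"
  have MM: "set (canon m) \<subseteq> B" "length (canon m) \<le> n" "set (z m) \<subseteq> B" "length (z m) \<le> n"
    if "m \<in> MM" for m
  proof -
    have "set (canon m) = set_mset m" "length (canon m) = size m"
      using canon by (metis set_mset_mset, metis size_mset)
    then show "set (canon m) \<subseteq> B" "length (canon m) \<le> n" using that E_subset by (auto simp: MM_def)
    then show "set (z m) \<subseteq> B" "length (z m) \<le> n" using \<nu>(1) by (auto simp: z_def)
  qed
  have z_closed: "lprod G (z m) \<in> carrier G" if "m \<in> MM" for m
    using MM(3)[OF that] B_closed by auto
  have "finite MM" "card MM \<le> (n + 1) ^ card E"
    unfolding MM_def using multisets_bounded[OF finite_E] by auto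
  moreover have "(n + 1) ^ card E \<le> (n + 1) ^ (3 * Suc r)"
    by (intro power_increasing card_E) auto
  ultimately have fin: "finite Y" and card: "card Y \<le> (n + 1) ^ (3 * Suc r)"
    using card_image_le[of MM] unfolding Y_def by (auto intro: order_trans)
  have "w \<in> Y <#> (set_power G T ((n * step_cost M + perm_cost M) * c M + n * (D * c M))
      <#> set_prod G (map Bs [0..<Suc r]))"
    if w: "w \<in> set_power G (T \<union> B \<union> m_inv G ` B) n" for w
  proof -
    obtain xs where xs: "set xs \<subseteq> T \<union> B \<union> m_inv G ` B" "length xs = n" "w = lprod G xs"
      using w by (auto simp: mem_set_power)
    obtain es bs where *: "set es \<subseteq> E" "length es \<le> n" "normal_form bs"
      "near (n * step_cost M) w (lprod G (es @ bs))"
      using near_normal_form[OF xs(1), of M] xs by (auto simp: M_def)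
    define m where "m = mset es"
    have m: "m \<in> MM" using * by (auto simp: m_def MM_def)
    have lbs: "length bs = Suc r" using *(3) by (simp add: normal_form_def)
    have B: "set es \<subseteq> B" "set bs \<subseteq> B" using * E_subset normal_B by auto
    note cl = B_list_closed[OF B(2)] B_list_closed[OF MM(1)[OF m]] z_closed[OF m]
    have "near (perm_cost M) (lprod G (es @ bs)) (lprod G (canon m @ bs))"
      using B lbs *(2) canon by (intro near_perm) (auto simp: m_def M_def)
    with *(4) have 1: "near (n * step_cost M + perm_cost M) w (lprod G (canon m) \<otimes> lprod G bs)"
      using near_trans cl by (auto simp: lprod_append)
    have 2: "near ((n * step_cost M + perm_cost M) * c M)
        (lprod G (z m) \<otimes> w) (lprod G (z m) \<otimes> (lprod G (canon m) \<otimes> lprod G bs))"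
      using MM[OF m] 1 cl by (intro near_left) (auto simp: M_def)
    have "near (length (canon m) * (D * c M)) (lprod G (z m) \<otimes> lprod G (canon m)) \<one>"
      unfolding z_def using MM[OF m] by (intro \<nu>(2)) (auto simp: M_def)
    then have "near (n * (D * c M)) (lprod G (z m) \<otimes> lprod G (canon m)) \<one>"
      using MM(2)[OF m] by (auto intro: near_mono)
    from near_right[OF this, of "lprod G bs"]
    have 3: "near (n * (D * c M)) (lprod G (z m) \<otimes> (lprod G (canon m) \<otimes> lprod G bs)) (lprod G bs)"
      using cl by (simp add: m_assoc)
    obtain t where t: "t \<in> set_power G T ((n * step_cost M + perm_cost M) * c M + n * (D * c M))"
      "lprod G (z m) \<otimes> w = t \<otimes> lprod G bs"
      using near_trans[OF 2 3] cl by (auto simp: near_def)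
    have "w \<in> carrier G"
      using xs T_closed B_closed by (auto intro!: lprod_closed)
    then have "w = inv (lprod G (z m)) \<otimes> (lprod G (z m) \<otimes> w)"
      using cl by (simp add: m_assoc[symmetric])
    then have "w = inv (lprod G (z m)) \<otimes> (t \<otimes> lprod G bs)" using t(2) by simp
    moreover have "lprod G bs \<in> set_prod G (map Bs [0..<Suc r])"
      unfolding mem_set_prod using *(3)
      by (intro exI[of _ bs]) (auto simp: list_all2_conv_all_nth normal_form_def simp del: upt_Suc)
    moreover have "inv (lprod G (z m)) \<in> Y" using m by (simp add: Y_def)
    ultimately show ?thesis using t(1) unfolding mem_set_mult[of w] by (blast intro: set_multI)
  qed
  then show ?thesis
    using fin card z_closed by (intro exI[of _ Y]) (auto simp: Y_def)
qed

end

section \<open>The layers of a coset nilprogression\<close>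

text \<open>\<open>n = 0\<close> is excluded because \<open>C * n ^ d\<close> vanishes there for
  positive \<open>d\<close>.\<close>

definition poly_bounded :: "(nat \<Rightarrow> nat) \<Rightarrow> bool" where
  "poly_bounded f \<longleftrightarrow> (\<exists>C d. \<forall>n\<ge>1. f n \<le> C * n ^ d)"

lemma poly_bounded_const: "poly_bounded (\<lambda>n. k)"
  unfolding poly_bounded_def by (intro exI[of _ k] exI[of _ 0]) simp

lemma poly_bounded_id: "poly_bounded (\<lambda>n. n)"
  unfolding poly_bounded_def by (intro exI[of _ 1]) simp

lemma poly_bounded_add:
  assumes "poly_bounded f" "poly_bounded g"
  shows "poly_bounded (\<lambda>n. f n + g n)"
proof -
  obtain C d C' d' where *: "\<And>n. n \<ge> 1 \<Longrightarrow> f n \<le> C * n ^ d" "\<And>n. n \<ge> 1 \<Longrightarrow> g n \<le> C' * n ^ d'"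
    using assms unfolding poly_bounded_def by blast
  have "f n + g n \<le> (C + C') * n ^ (d + d')" if n: "n \<ge> 1" for n
  proof -
    have "f n + g n \<le> C * n ^ d + C' * n ^ d'"
      using *[OF n] by simp
    also have "\<dots> \<le> C * n ^ (d + d') + C' * n ^ (d + d')"
      using n by (intro add_mono mult_left_mono power_increasing) auto
    finally show ?thesis by (simp add: algebra_simps)
  qed
  then show ?thesis unfolding poly_bounded_def by blast
qed

lemma poly_bounded_mult:
  assumes "poly_bounded f" "poly_bounded g"
  shows "poly_bounded (\<lambda>n. f n * g n)"
proof -
  obtain C d C' d' where *: "\<And>n. n \<ge> 1 \<Longrightarrow> f n \<le> C * n ^ d" "\<And>n. n \<ge> 1 \<Longrightarrow> g n \<le> C' * n ^ d'"
    using assms unfolding poly_bounded_def by blast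
  have "f n * g n \<le> (C * C') * n ^ (d + d')" if n: "n \<ge> 1" for n
    using mult_mono[OF *[OF n]] by (simp add: power_add mult_ac)
  then show ?thesis unfolding poly_bounded_def by blast
qed

lemma poly_bounded_power: "poly_bounded f \<Longrightarrow> poly_bounded (\<lambda>n. f n ^ k)"
  by (induction k) (auto intro: poly_bounded_const poly_bounded_mult)

lemmas poly_bounded_intros =
  poly_bounded_const poly_bounded_id poly_bounded_add poly_bounded_mult poly_bounded_power

section \<open>Ranks of letters and the costs they lead to\<close>

text \<open>Exceeds every \<open>r k\<close> with \<open>k \<le> l\<close>, so the ranks of the
  letters of different layers lie in disjoint blocks of this length.\<close>

definition width :: "nat \<Rightarrow> (nat \<Rightarrow> nat) \<Rightarrow> nat" where
  "width l r = Suc (\<Sum>k\<le>l. r k)"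

text \<open>The letter \<open>\<phi> k j x\<close> has rank \<open>(l - k) * width l r + j\<close>: the commutators in the axioms
  are words in letters of smaller rank, except that \<open>j = 0\<close> may reproduce the rank itself.\<close>

definition letters ::
  "nat \<Rightarrow> (nat \<Rightarrow> nat) \<Rightarrow> (nat \<Rightarrow> 'h monoid) \<Rightarrow> (nat \<Rightarrow> nat \<Rightarrow> nat)
     \<Rightarrow> (nat \<Rightarrow> nat \<Rightarrow> 'h + int \<Rightarrow> 'a) \<Rightarrow> nat \<Rightarrow> 'a set" where
  "letters l r H N \<phi> w = {\<phi> k j x | k j x. 1 \<le> k \<and> k \<le> l \<and> j \<le> r k \<and> x \<in> idx H N k j \<and>
     (l - k) * width l r + j < w}"

definition sym_letters ::
  "'a monoid \<Rightarrow> nat \<Rightarrow> (nat \<Rightarrow> nat) \<Rightarrow> (nat \<Rightarrow> 'h monoid) \<Rightarrow> (nat \<Rightarrow> nat \<Rightarrow> nat)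
     \<Rightarrow> (nat \<Rightarrow> nat \<Rightarrow> 'h + int \<Rightarrow> 'a) \<Rightarrow> nat \<Rightarrow> 'a set" where
  "sym_letters G l r H N \<phi> w =
     insert \<one>\<^bsub>G\<^esub> (letters l r H N \<phi> w \<union> m_inv G ` letters l r H N \<phi> w)"

text \<open>An element of a product \<open>A i\<close> is a word of at most
  \<open>Suc l * width l r\<close> letters; the factor 2 allows for the two such words into which a
  commutator decomposes.\<close>

definition word_bound :: "nat \<Rightarrow> (nat \<Rightarrow> nat) \<Rightarrow> nat" where
  "word_bound l r = 2 * (Suc l * width l r)"

text \<open>The bound of \<open>iterated_conj\<close> for \<open>m\<close> letters of layer
  \<open>i\<close>; the exponent is the number of ranks reserved for the later layers.\<close>

definition conj_cost :: "nat \<Rightarrow> (nat \<Rightarrow> nat) \<Rightarrow> nat \<Rightarrow> nat \<Rightarrow> nat" where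
  "conj_cost l r i m = (1 + 2 * word_bound l r * m) ^ ((l - i) * width l r)"

text \<open>Determined by the overflow case: one use of \<open>phi_add\<close> behind a single
  letter of the layer, and one at the left end.\<close>

definition swap_cost :: "nat \<Rightarrow> (nat \<Rightarrow> nat) \<Rightarrow> nat \<Rightarrow> nat" where
  "swap_cost l r i = word_bound l r * conj_cost l r i 1 + word_bound l r"

text \<open>The word length in \<open>cover\<close> with all costs unfolded. It depends on
  \<open>l\<close>, \<open>r\<close>, \<open>i\<close> and \<open>n\<close> alone, not on the group
  or on \<open>N\<close>.\<close>

definition cover_cost :: "nat \<Rightarrow> (nat \<Rightarrow> nat) \<Rightarrow> nat \<Rightarrow> nat \<Rightarrow> nat" where
  "cover_cost l r i n =
     (let M = n + r i + 3; c = conj_cost l r i M; D = swap_cost l r i; p = M * (M * D * c * c)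
      in (n * (2 * p + 2 * (D * c) + c) + p) * c + n * (D * c))"

lemma poly_bounded_cover_cost: "poly_bounded (cover_cost l r i)"
  unfolding cover_cost_def[abs_def] Let_def conj_cost_def by (intro poly_bounded_intros)

lemma rank_less: "\<lbrakk>k \<le> l; j \<le> r k\<rbrakk> \<Longrightarrow> j < width l r"
  using member_le_sum[of k "{..l}" r] by (auto simp: width_def)

context monoid_group begin

lemma set_prod_subset_power:
  "(\<And>X. X \<in> set Xs \<Longrightarrow> X \<subseteq> T) \<Longrightarrow> set_prod G Xs \<subseteq> set_power G T (length Xs)"
  by (induction Xs) (auto simp: mem_set_mult, blast)

end

context coset_nilprogression begin

sublocale monoid_group G
  by (rule monoid_group.intro) (rule group_G)

abbreviation A where "A \<equiv> layers_from G l r H N \<phi>"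
abbreviation L where "L \<equiv> layer_upto G H N \<phi>"
abbreviation W where "W \<equiv> width l r"
abbreviation U where "U \<equiv> sym_letters G l r H N \<phi>"
abbreviation D0 where "D0 \<equiv> word_bound l r"
abbreviation P where "P w n \<equiv> set_power G (U w) n"

lemma letters_closed: "letters l r H N \<phi> w \<subseteq> carrier G"
  using phi_closed by (auto simp: letters_def)

lemma letters_mono: "w \<le> w' \<Longrightarrow> letters l r H N \<phi> w \<subseteq> letters l r H N \<phi> w'"
  unfolding letters_def by fastforce

lemma U_closed: "U w \<subseteq> carrier G"
  using letters_closed by (auto simp: sym_letters_def)

lemma U_one: "\<one>\<^bsub>G\<^esub> \<in> U w"
  by (simp add: sym_letters_def)

lemma U_inv: "t \<in> U w \<Longrightarrow> inv\<^bsub>G\<^esub> t \<in> U w"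
  using letters_closed[of w] by (auto simp: sym_letters_def)

lemma U_mono: "w \<le> w' \<Longrightarrow> U w \<subseteq> U w'"
  using letters_mono[of w w'] by (auto simp: sym_letters_def)

lemma P_mono: "\<lbrakk>x \<in> P w n; w \<le> w'; n \<le> n'\<rbrakk> \<Longrightarrow> x \<in> P w' n'"
  using set_power_mono[OF U_closed U_one] set_power_mono_set[OF U_mono] by blast

lemma P_closed: "x \<in> P w n \<Longrightarrow> x \<in> carrier G"
  using set_power_closed[OF U_closed] by blast

lemma P_mult: "\<lbrakk>x \<in> P w m; y \<in> P w n\<rbrakk> \<Longrightarrow> x \<otimes>\<^bsub>G\<^esub> y \<in> P w (m + n)"
  by (rule set_power_mult[OF U_closed])

lemma P_inv: "x \<in> P w m \<Longrightarrow> inv\<^bsub>G\<^esub> x \<in> P w m"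
  by (rule set_power_inv[OF U_closed U_inv])

lemma phi_in_U:
  "\<lbrakk>1 \<le> k; k \<le> l; j \<le> r k; x \<in> idx H N k j; (l - k) * W + j < w\<rbrakk> \<Longrightarrow> \<phi> k j x \<in> U w"
  by (auto simp: sym_letters_def letters_def)

lemma layer_upto_subset:
  assumes "1 \<le> k" "k \<le> l" "j \<le> r k"
  shows "L k j \<subseteq> P ((l - k) * W + Suc j) (Suc j)"
proof -
  have "L k j \<subseteq> P ((l - k) * W + Suc j) (length (map (\<lambda>j. \<phi> k j ` idx H N k j) [0..<Suc j]))"
    unfolding layer_upto_def using assms
    by (intro set_prod_subset_power) (auto intro!: phi_in_U simp del: upt_Suc)
  then show ?thesis by simp
qed

lemma L_closed: "\<lbrakk>1 \<le> k; k \<le> l; j \<le> r k\<rbrakk> \<Longrightarrow> L k j \<subseteq> carrier G"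
  using layer_upto_subset P_closed by blast

lemma layers_from_Suc:
  assumes "1 \<le> i" "i \<le> l"
  shows "A i = A (Suc i) <#>\<^bsub>G\<^esub> L i (r i)"
proof -
  have eq: "rev [i..<Suc l] = rev [Suc i..<Suc l] @ [i]" using assms by (simp add: upt_conv_Cons del: upt_Suc)
  have "L i (r i) <#>\<^bsub>G\<^esub> {\<one>\<^bsub>G\<^esub>} = L i (r i)"
    using L_closed[OF assms order_refl] by (force simp: set_mult_def)
  moreover have cl: "L k (r k) \<subseteq> carrier G" if "i \<le> k" "k < Suc l" for k
    using assms that by (intro L_closed) auto
  ultimately show ?thesis
    unfolding layers_from_def eq map_append using assms
    by (subst set_prod_append) (auto simp del: upt_Suc dest: subsetD[OF cl, rotated 2])
qed

lemma layers_from_last: "A (Suc l) = {\<one>\<^bsub>G\<^esub>}"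
  by (simp add: layers_from_def)

text \<open>Layer \<open>k\<close> contributes \<open>Suc (r k) \<le> W\<close> letters with ranks
  in its own block of length \<open>W\<close>, so the same number bounds the length and the
  ranks.\<close>

lemma layers_from_subset:
  assumes "1 \<le> i"
  shows "A i \<subseteq> P ((Suc l - i) * W) ((Suc l - i) * W)"
  using assms
proof (induction "Suc l - i" arbitrary: i)
  case 0
  then show ?case by (auto simp: layers_from_def)
next
  case (Suc m)
  then have il: "i \<le> l" by simp
  have *: "Suc l - i = Suc (l - i)" using il by simp
  have IH: "A (Suc i) \<subseteq> P ((l - i) * W) ((l - i) * W)"
    using Suc(1)[of "Suc i"] Suc(2) by simp
  have "L i (r i) \<subseteq> P ((l - i) * W + Suc (r i)) (Suc (r i))"
    using layer_upto_subset Suc.prems il by simp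
  moreover have "Suc (r i) \<le> W" using rank_less[of i l "r i" r] il by simp
  ultimately have 1: "L i (r i) \<subseteq> P ((Suc l - i) * W) W" unfolding *
    using P_mono[where w = "(l - i) * W + Suc (r i)" and n = "Suc (r i)"] by fastforce
  have 2: "A (Suc i) \<subseteq> P ((Suc l - i) * W) ((l - i) * W)"
    unfolding * using IH P_mono[where w = "(l - i) * W" and n = "(l - i) * W"] by fastforce
  have "x \<in> P ((Suc l - i) * W) ((l - i) * W + W)" if x: "x \<in> A i" for x
    using x P_mult 1 2 unfolding layers_from_Suc[OF Suc.prems il] mem_set_mult by blast
  then show ?case unfolding * by (auto simp: add.commute)
qed

lemma layers_from_word:
  assumes "1 \<le> i" "(Suc l - i) * W \<le> w" "x \<in> A i"
  shows "x \<in> P w (Suc l * W)"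
  using layers_from_subset[OF assms(1)] assms P_mono[OF _ assms(2)]
  by (meson diff_le_self mult_le_mono1 subsetD)

section \<open>Conjugating a letter by a letter of an earlier layer\<close>

lemma commutator_swap:
  assumes "g \<in> carrier G" "s \<in> carrier G"
  shows "g \<otimes>\<^bsub>G\<^esub> s = commutator G g s \<otimes>\<^bsub>G\<^esub> s \<otimes>\<^bsub>G\<^esub> g"
proof -
  have "commutator G g s \<otimes>\<^bsub>G\<^esub> s \<otimes>\<^bsub>G\<^esub> g = g \<otimes>\<^bsub>G\<^esub> s \<otimes>\<^bsub>G\<^esub> inv\<^bsub>G\<^esub> g \<otimes>\<^bsub>G\<^esub> (inv\<^bsub>G\<^esub> s \<otimes>\<^bsub>G\<^esub> s) \<otimes>\<^bsub>G\<^esub> g"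
    using assms unfolding commutator_def by (simp add: m_assoc)
  also have "\<dots> = g \<otimes>\<^bsub>G\<^esub> s"
    using assms by (simp add: m_assoc)
  finally show ?thesis by simp
qed

text \<open>By \<open>phi_commutator_lower\<close> the commutator is a product of \<open>a\<close>
  from layers after \<open>k\<close> and \<open>b\<close> from kinds below \<open>j\<close> in layer
  \<open>k\<close>. For positive \<open>j\<close> both are short words in letters of smaller rank
  than \<open>s\<close>.\<close>

lemma conj_positive_letter:
  assumes i: "1 \<le> i" "i \<le> l" "j' \<le> r i" "y \<in> idx H N i j'" and w: "w < (l - i) * W"
    and s: "s \<in> letters l r H N \<phi> (Suc w)"
  shows "\<exists>t\<in>P w D0. \<exists>s'\<in>letters l r H N \<phi> (Suc w). \<phi> i j' y \<otimes>\<^bsub>G\<^esub> s = t \<otimes>\<^bsub>G\<^esub> s' \<otimes>\<^bsub>G\<^esub> \<phi> i j' y"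
proof -
  define g where "g = \<phi> i j' y"
  obtain k j x where k: "1 \<le> k" "k \<le> l" "j \<le> r k" "x \<in> idx H N k j" "(l - k) * W + j \<le> w"
    and s_eq: "s = \<phi> k j x" using s by (auto simp: letters_def less_Suc_eq_le)
  \<comment> \<open>The bound on \<open>w\<close> forces \<open>s\<close> into a layer after
    \<open>i\<close>, as \<open>phi_commutator_lower\<close> requires.\<close>
  have "(l - k) * W < (l - i) * W"
    by (rule le_less_trans[OF le_trans[OF le_add1 k(5)] w])
  then have "l - k < l - i" by (metis mult_less_cancel2)
  then have ik: "i < k" by simp
  have gs: "g \<in> carrier G" "s \<in> carrier G" unfolding g_def s_eq using i k phi_closed by auto
  have "commutator G g s \<in> A (k + 1) <#>\<^bsub>G\<^esub> L k (j - 1)"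
    unfolding g_def s_eq using i k ik by (intro phi_commutator_lower)
  then obtain a b where ab: "a \<in> A (k + 1)" "b \<in> L k (j - 1)" "commutator G g s = a \<otimes>\<^bsub>G\<^esub> b"
    by (auto simp: mem_set_mult)
  have A_word: "x \<in> P w (Suc l * W)" if "x \<in> A (k + 1)" for x
    using that k by (intro layers_from_word) auto
  have aw: "a \<in> P w (Suc l * W)" using A_word ab(1) .
  have cl: "a \<in> carrier G" "b \<in> carrier G"
    using aw P_closed subsetD[OF L_closed[of k "j - 1"] ab(2)] k by auto
  have eq: "g \<otimes>\<^bsub>G\<^esub> s = a \<otimes>\<^bsub>G\<^esub> (b \<otimes>\<^bsub>G\<^esub> s) \<otimes>\<^bsub>G\<^esub> g"
    using commutator_swap[OF gs] ab(3) cl gs by (simp add: m_assoc)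
  have D0: "Suc l * W + Suc l * W = D0" by (simp add: word_bound_def)
  show ?thesis
  \<comment> \<open>For \<open>j = 0\<close> the truncated \<open>j - 1\<close> is again
    \<open>0\<close>, so \<open>b\<close> may have the rank of \<open>s\<close>. Both then come from
    the group \<open>H k\<close>, where sums never overflow, and \<open>phi_add\<close> merges them
    into one letter of that rank.\<close>
  proof (cases "j = 0")
    case True
    then have "b \<in> \<phi> k 0 ` idx H N k 0"
      using ab(2) k phi_closed by (auto simp: layer_upto_def mem_set_mult)
    then obtain x' where x': "x' \<in> idx H N k 0" "b = \<phi> k 0 x'" by blast
    have add: "idx_add H k x' x \<in> idx H N k 0"
    proof -
      interpret H: comm_group "H k" using comm_group_H k by simp
      show ?thesis using x'(1) k(4) True by (auto simp: idx_def idx_add_def)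
    qed
    then have "b \<otimes>\<^bsub>G\<^esub> s \<in> A (k + 1) <#>\<^bsub>G\<^esub> {\<phi> k 0 (idx_add H k x' x)}"
      unfolding x'(2) s_eq True using k x' True by (intro phi_add) auto
    then obtain a' where a': "a' \<in> A (k + 1)" "b \<otimes>\<^bsub>G\<^esub> s = a' \<otimes>\<^bsub>G\<^esub> \<phi> k 0 (idx_add H k x' x)"
      by (auto simp: mem_set_mult)
    have aw': "a' \<in> P w (Suc l * W)" using A_word a'(1) .
    have s': "\<phi> k 0 (idx_add H k x' x) \<in> letters l r H N \<phi> (Suc w)"
      unfolding letters_def using k add True by fastforce
    have "g \<otimes>\<^bsub>G\<^esub> s = (a \<otimes>\<^bsub>G\<^esub> a') \<otimes>\<^bsub>G\<^esub> \<phi> k 0 (idx_add H k x' x) \<otimes>\<^bsub>G\<^esub> g"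
      using eq a'(2) cl gs P_closed[OF aw'] subsetD[OF letters_closed s'] by (simp add: m_assoc)
    moreover have "a \<otimes>\<^bsub>G\<^esub> a' \<in> P w D0" using P_mult[OF aw aw'] D0 by simp
    ultimately show ?thesis using s' unfolding g_def[symmetric] by blast
  next
    case False
    have "b \<in> P ((l - k) * W + Suc (j - 1)) (Suc (j - 1))"
      by (rule subsetD[OF layer_upto_subset ab(2)]) (use k in auto)
    moreover have "j \<le> W" using rank_less[of k l j r] k by simp
    ultimately have "b \<in> P w (Suc l * W)"
      using False k(5) by (elim P_mono) (auto simp: trans_le_add1)
    then have "a \<otimes>\<^bsub>G\<^esub> b \<in> P w D0" using P_mult[OF aw] D0 by metis
    moreover have "g \<otimes>\<^bsub>G\<^esub> s = (a \<otimes>\<^bsub>G\<^esub> b) \<otimes>\<^bsub>G\<^esub> s \<otimes>\<^bsub>G\<^esub> g"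
      using eq cl gs by (simp add: m_assoc)
    ultimately show ?thesis using s unfolding g_def[symmetric] by blast
  qed
qed

text \<open>For an inverse letter the relation for \<open>u\<close> is inverted, which puts the
  short word on the right of the letter. This is why errors are allowed on both sides.\<close>

lemma conj_letter:
  assumes i: "1 \<le> i" "i \<le> l" "j' \<le> r i" "y \<in> idx H N i j'" and w: "w < (l - i) * W"
    and s: "s \<in> U (Suc w)"
  shows "\<exists>t\<in>P w D0. \<exists>s'\<in>U (Suc w). \<exists>t'\<in>P w D0.
    \<phi> i j' y \<otimes>\<^bsub>G\<^esub> s = t \<otimes>\<^bsub>G\<^esub> s' \<otimes>\<^bsub>G\<^esub> t' \<otimes>\<^bsub>G\<^esub> \<phi> i j' y"
proof -
  define g where "g = \<phi> i j' y"
  have g: "g \<in> carrier G" unfolding g_def using i phi_closed by auto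
  have one: "\<one>\<^bsub>G\<^esub> \<in> P w D0" by (rule P_mono[where w = w and n = 0]) auto
  consider "s = \<one>\<^bsub>G\<^esub>" | "s \<in> letters l r H N \<phi> (Suc w)"
    | u where "u \<in> letters l r H N \<phi> (Suc w)" "s = inv\<^bsub>G\<^esub> u"
    using s by (auto simp: sym_letters_def)
  then show ?thesis
  proof cases
    case 1
    then show ?thesis unfolding g_def[symmetric] using one U_one g by (intro bexI[of _ "\<one>\<^bsub>G\<^esub>"]) auto
  next
    case 2
    from conj_positive_letter[OF i w this]
    obtain t s' where t: "t \<in> P w D0" "s' \<in> letters l r H N \<phi> (Suc w)"
      "g \<otimes>\<^bsub>G\<^esub> s = t \<otimes>\<^bsub>G\<^esub> s' \<otimes>\<^bsub>G\<^esub> g" unfolding g_def[symmetric] by blast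
    have "t \<in> carrier G" "s' \<in> carrier G" using t(1,2) P_closed subsetD[OF letters_closed] by auto
    then show ?thesis unfolding g_def[symmetric] using t one g
      by (intro bexI[of _ t] bexI[of _ s'] bexI[of _ "\<one>\<^bsub>G\<^esub>"]) (auto simp: sym_letters_def)
  next
    case 3
    from conj_positive_letter[OF i w 3(1)]
    obtain t s' where t: "t \<in> P w D0" "s' \<in> letters l r H N \<phi> (Suc w)"
      "g \<otimes>\<^bsub>G\<^esub> u = t \<otimes>\<^bsub>G\<^esub> s' \<otimes>\<^bsub>G\<^esub> g" unfolding g_def[symmetric] by blast
    have cl: "t \<in> carrier G" "s' \<in> carrier G" "u \<in> carrier G"
      using t(1,2) 3(1) P_closed subsetD[OF letters_closed] by auto
    have "g \<otimes>\<^bsub>G\<^esub> inv\<^bsub>G\<^esub> u = inv\<^bsub>G\<^esub> s' \<otimes>\<^bsub>G\<^esub> (inv\<^bsub>G\<^esub> t \<otimes>\<^bsub>G\<^esub> t) \<otimes>\<^bsub>G\<^esub> s' \<otimes>\<^bsub>G\<^esub> g \<otimes>\<^bsub>G\<^esub> inv\<^bsub>G\<^esub> u"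
      using cl g by simp
    also have "\<dots> = inv\<^bsub>G\<^esub> s' \<otimes>\<^bsub>G\<^esub> inv\<^bsub>G\<^esub> t \<otimes>\<^bsub>G\<^esub> (t \<otimes>\<^bsub>G\<^esub> s' \<otimes>\<^bsub>G\<^esub> g) \<otimes>\<^bsub>G\<^esub> inv\<^bsub>G\<^esub> u"
      using cl g by (simp only: m_assoc m_closed inv_closed)
    also have "\<dots> = inv\<^bsub>G\<^esub> s' \<otimes>\<^bsub>G\<^esub> inv\<^bsub>G\<^esub> t \<otimes>\<^bsub>G\<^esub> (g \<otimes>\<^bsub>G\<^esub> u) \<otimes>\<^bsub>G\<^esub> inv\<^bsub>G\<^esub> u"
      using t(3) by simp
    also have "\<dots> = \<one>\<^bsub>G\<^esub> \<otimes>\<^bsub>G\<^esub> inv\<^bsub>G\<^esub> s' \<otimes>\<^bsub>G\<^esub> inv\<^bsub>G\<^esub> t \<otimes>\<^bsub>G\<^esub> g"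
      using cl g by (simp add: m_assoc)
    finally show ?thesis unfolding g_def[symmetric] using t one P_inv[OF t(1)] 3(2)
      by (intro bexI[of _ "\<one>\<^bsub>G\<^esub>"] bexI[of _ "inv\<^bsub>G\<^esub> s'"] bexI[of _ "inv\<^bsub>G\<^esub> t"])
        (auto simp: sym_letters_def)
  qed
qed

end

section \<open>Covering by translates\<close>

lemma Inr_idx: "j \<noteq> 0 \<Longrightarrow> Inr k \<in> idx H N i j \<longleftrightarrow> \<bar>k\<bar> \<le> int (N i j)"
  by (auto simp: idx_def image_iff abs_le_iff)

context coset_nilprogression begin

section \<open>One layer of a coset nilprogression as an abelian layer\<close>

definition layer_letters :: "nat \<Rightarrow> 'a set" where
  "layer_letters i = (\<Union>j\<le>r i. \<phi> i j ` idx H N i j)"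

text \<open>For \<open>j = 0\<close> the indices form a group and nothing overflows;
  \<open>\<one>\<close> stands for the absence of overflow.\<close>

definition overflow :: "nat \<Rightarrow> nat \<Rightarrow> 'a set" where
  "overflow i j =
     insert \<one>\<^bsub>G\<^esub> (if j = 0 then {} else {\<phi> i j (Inr (int (N i j))), \<phi> i j (Inr (- int (N i j)))})"

lemma layer_interpretation:
  assumes i: "1 \<le> i" "i \<le> l"
  shows "layer G (U ((l - i) * W)) (layer_letters i) (conj_cost l r i)"
proof
  show "layer_letters i \<subseteq> carrier G"
    using i phi_closed by (auto simp: layer_letters_def)
  show "mono (conj_cost l r i)"
    by (auto simp: mono_def conj_cost_def intro!: power_mono)
  show "\<exists>t\<in>P ((l - i) * W) (conj_cost l r i (length gs)). lprod G gs \<otimes>\<^bsub>G\<^esub> s = t \<otimes>\<^bsub>G\<^esub> lprod G gs"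
    if "set gs \<subseteq> layer_letters i" "s \<in> U ((l - i) * W)" for gs s
    unfolding conj_cost_def
  proof (rule iterated_conj[where U = U and W = "(l - i) * W" and D = D0])
    show "U 0 = {\<one>\<^bsub>G\<^esub>}" by (simp add: sym_letters_def letters_def)
    show "\<exists>t\<in>P w D0. \<exists>s'\<in>U (Suc w). \<exists>t'\<in>P w D0. g \<otimes>\<^bsub>G\<^esub> s = t \<otimes>\<^bsub>G\<^esub> s' \<otimes>\<^bsub>G\<^esub> t' \<otimes>\<^bsub>G\<^esub> g"
      if "g \<in> layer_letters i" "w < (l - i) * W" "s \<in> U (Suc w)" for g s w
      using that i conj_letter[of i _ _ w s] unfolding layer_letters_def by blast
  qed (use U_closed U_one U_mono \<open>layer_letters i \<subseteq> carrier G\<close> that in auto)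
qed (use U_closed U_one U_inv in auto)

lemma idx_neg:
  assumes i: "1 \<le> i" "i \<le> l" "j \<le> r i" "x \<in> idx H N i j"
  shows "\<exists>x'\<in>idx H N i j. idx_add H i x' x = idx_zero H i j"
proof (cases "j = 0")
  case True
  interpret H: comm_group "H i" using comm_group_H i by simp
  obtain h where h: "h \<in> carrier (H i)" "x = Inl h" using i True by (auto simp: idx_def)
  then show ?thesis using True
    by (intro bexI[of _ "Inl (inv\<^bsub>H i\<^esub> h)"]) (auto simp: idx_def idx_add_def idx_zero_def)
next
  case False
  then obtain m where "x = Inr m" "- int (N i j) \<le> m" "m \<le> int (N i j)"
    using i by (auto simp: idx_def)
  then show ?thesis using False
    by (intro bexI[of _ "Inr (- m)"]) (auto simp: idx_def idx_add_def idx_zero_def)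
qed

lemma idx_zero_mem:
  assumes "1 \<le> i" "i \<le> l"
  shows "idx_zero H i j \<in> idx H N i j"
proof -
  interpret H: comm_group "H i" using comm_group_H assms by simp
  show ?thesis by (auto simp: idx_def idx_zero_def)
qed

text \<open>Elements of \<open>A (i + 1)\<close> are short words in later letters, so
  \<open>phi_add\<close> and \<open>phi_commutator_same\<close> become statements about
  \<open>near\<close>. Only sums that leave the interval need an argument.\<close>

lemma abelian_layer_interpretation:
  assumes i: "1 \<le> i" "i \<le> l"
  shows "abelian_layer G (U ((l - i) * W)) (layer_letters i) (conj_cost l r i) (swap_cost l r i)
    (r i) (\<lambda>j. \<phi> i j ` idx H N i j) (overflow i)"
proof -
  interpret layer G "U ((l - i) * W)" "layer_letters i" "conj_cost l r i"
    using i by (rule layer_interpretation)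
  have D: "D0 \<le> swap_cost l r i" by (simp add: swap_cost_def)
  have A_near: "near D0 (a \<otimes>\<^bsub>G\<^esub> y) y" if "a \<in> A (i + 1)" for a y
  proof -
    have "a \<in> P ((l - i) * W) (Suc l * W)" using that i by (intro layers_from_word) auto
    then have "a \<in> P ((l - i) * W) D0" by (rule P_mono) (auto simp: word_bound_def)
    then show ?thesis by (auto simp: near_def)
  qed
  have \<phi>_add: "near D0 (\<phi> i j x \<otimes>\<^bsub>G\<^esub> \<phi> i j y) (\<phi> i j (idx_add H i x y))"
    if "j \<le> r i" "x \<in> idx H N i j" "y \<in> idx H N i j" "idx_add H i x y \<in> idx H N i j" for j x y
    using phi_add[OF i that] A_near by (auto simp: mem_set_mult)
  note \<phi>_closed = phi_closed[OF i]
  note \<phi>_zero = phi_zero[OF i]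
  have in_layer: "\<phi> i j x \<in> layer_letters i" if "j \<le> r i" "x \<in> idx H N i j" for j x
    using that by (auto simp: layer_letters_def)
  show ?thesis
  proof
    show "near (swap_cost l r i) (x \<otimes>\<^bsub>G\<^esub> y) (y \<otimes>\<^bsub>G\<^esub> x)"
      if xy: "x \<in> layer_letters i" "y \<in> layer_letters i" for x y
    proof -
      have cl: "x \<in> carrier G" "y \<in> carrier G" using xy B_closed by auto
      have "commutator G x y \<in> A (i + 1)"
        using xy phi_commutator_same[OF i] by (auto simp: layer_letters_def)
      moreover have "commutator G x y \<in> carrier G" using cl by (simp add: commutator_def)
      ultimately have "near D0 (x \<otimes>\<^bsub>G\<^esub> y) (y \<otimes>\<^bsub>G\<^esub> x)"
        using commutator_swap[OF cl] A_near[of "commutator G x y" "y \<otimes>\<^bsub>G\<^esub> x"] cl by (simp add: m_assoc)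
      then show ?thesis using D by (rule near_mono)
    qed
    show "layer_letters i = (\<Union>j\<le>r i. \<phi> i j ` idx H N i j)" by (simp add: layer_letters_def)
    fix j assume j: "j \<le> r i"
    show one: "\<one>\<^bsub>G\<^esub> \<in> \<phi> i j ` idx H N i j"
      using \<phi>_zero[OF j] idx_zero_mem[OF i, of j] by (metis imageI)
    show "overflow i j \<subseteq> \<phi> i j ` idx H N i j"
      using one by (auto simp: overflow_def idx_def)
    show "finite (overflow i j)" "card (overflow i j) \<le> 3"
      by (auto simp: overflow_def card_insert_if)
    show "\<exists>b\<in>\<phi> i j ` idx H N i j. near (swap_cost l r i) (inv\<^bsub>G\<^esub> x) b"
      if x: "x \<in> \<phi> i j ` idx H N i j" for x
    proof -
      obtain h where h: "h \<in> idx H N i j" "x = \<phi> i j h" using x by blast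
      obtain h' where h': "h' \<in> idx H N i j" "idx_add H i h' h = idx_zero H i j"
        using idx_neg[OF i j h(1)] by blast
      have cl: "x \<in> carrier G" "\<phi> i j h' \<in> carrier G" using \<phi>_closed[OF j] h h' by auto
      have "near D0 (\<phi> i j h' \<otimes>\<^bsub>G\<^esub> x) \<one>\<^bsub>G\<^esub>"
        using \<phi>_add[OF j h'(1) h(1)] idx_zero_mem[OF i] h' h \<phi>_zero[OF j] by auto
      from near_right[OF this, of "inv\<^bsub>G\<^esub> x"] have "near D0 (\<phi> i j h') (inv\<^bsub>G\<^esub> x)"
        using cl by (simp add: m_assoc)
      from near_mono[OF near_sym[OF this] D] show ?thesis using cl h' by auto
    qed
    show "\<exists>e\<in>overflow i j. \<exists>b\<in>\<phi> i j ` idx H N i j. near (swap_cost l r i) (x \<otimes>\<^bsub>G\<^esub> y) (e \<otimes>\<^bsub>G\<^esub> b)"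
      if xy: "x \<in> \<phi> i j ` idx H N i j" "y \<in> \<phi> i j ` idx H N i j" for x y
    proof -
      obtain h h' where h: "h \<in> idx H N i j" "x = \<phi> i j h" "h' \<in> idx H N i j" "y = \<phi> i j h'"
        using xy by blast
      show ?thesis
      proof (cases "idx_add H i h h' \<in> idx H N i j")
        case True
        have "near (swap_cost l r i) (x \<otimes>\<^bsub>G\<^esub> y) (\<phi> i j (idx_add H i h h'))"
          using \<phi>_add[OF j h(1,3) True] D near_mono unfolding h by blast
        then show ?thesis using True \<phi>_closed[OF j True]
          by (intro bexI[of _ "\<one>\<^bsub>G\<^esub>"] bexI[of _ "\<phi> i j (idx_add H i h h')"]) (auto simp: overflow_def)
      next
        case False
        have "j \<noteq> 0"
        proof
          assume "j = 0"
          interpret H: comm_group "H i" using comm_group_H i by simp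
          show False using False h \<open>j = 0\<close> by (auto simp: idx_def idx_add_def)
        qed
        then obtain m n where mn: "h = Inr m" "h' = Inr n" "\<bar>m\<bar> \<le> int (N i j)" "\<bar>n\<bar> \<le> int (N i j)"
          using h by (auto simp: idx_def)
        have big: "\<bar>m + n\<bar> > int (N i j)"
          using False mn \<open>j \<noteq> 0\<close> by (simp add: Inr_idx idx_add_def)
        define f where "f k = \<phi> i j (Inr k)" for k
        have f_idx: "Inr k \<in> idx H N i j" if "\<bar>k\<bar> \<le> int (N i j)" for k
          using that \<open>j \<noteq> 0\<close> by (simp add: Inr_idx)
        have f_add: "near D0 (f k \<otimes>\<^bsub>G\<^esub> f k') (f (k + k'))"
          if "\<bar>k\<bar> \<le> int (N i j)" "\<bar>k'\<bar> \<le> int (N i j)" "\<bar>k + k'\<bar> \<le> int (N i j)" for k k'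
          using \<phi>_add[OF j f_idx[OF that(1)] f_idx[OF that(2)]] f_idx[OF that(3)]
          by (auto simp: idx_add_def f_def)
        have f_closed: "f k \<in> carrier G" if "\<bar>k\<bar> \<le> int (N i j)" for k
          using \<phi>_closed[OF j f_idx[OF that]] by (simp add: f_def)
        \<comment> \<open>The endpoint with the sign of \<open>m + n\<close>. As
          \<open>m + n\<close> exceeds \<open>N i j\<close> in absolute value, \<open>m\<close> and
          \<open>n\<close> have this sign too, so \<open>s - m\<close> and \<open>m + n - s\<close>
          stay in the interval.\<close>
        define s where "s = (if m + n > 0 then int (N i j) else - int (N i j))"
        have s: "\<bar>s\<bar> \<le> int (N i j)" "\<bar>s - m\<bar> \<le> int (N i j)" "\<bar>m + n - s\<bar> \<le> int (N i j)"
          using big mn by (auto simp: s_def abs_if split: if_splits)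
        note cl = s[THEN f_closed] mn(3,4)[THEN f_closed]
        \<comment> \<open>\<open>n\<close> is split as \<open>(s - m) + (m + n - s)\<close>, and the
          first part is added to \<open>m\<close>; all three sums stay inside the interval, so
          \<open>phi_add\<close> applies.\<close>
        have 1: "near D0 (f m \<otimes>\<^bsub>G\<^esub> f (s - m)) (f s)"
          using f_add[of m "s - m"] mn s by simp
        have "near D0 (f (s - m) \<otimes>\<^bsub>G\<^esub> f (m + n - s)) (f n)"
          using f_add[of "s - m" "m + n - s"] mn s by simp
        then have "near D0 (f n) (f (s - m) \<otimes>\<^bsub>G\<^esub> f (m + n - s))"
          by (rule near_sym) (use cl in auto)
        then have "near (D0 * conj_cost l r i 1) (lprod G [f m] \<otimes>\<^bsub>G\<^esub> f n)
            (lprod G [f m] \<otimes>\<^bsub>G\<^esub> (f (s - m) \<otimes>\<^bsub>G\<^esub> f (m + n - s)))"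
          using cl in_layer[OF j f_idx[OF mn(3)]] by (intro near_left) (auto simp: f_def)
        then have "near (D0 * conj_cost l r i 1) (f m \<otimes>\<^bsub>G\<^esub> f n)
            (f m \<otimes>\<^bsub>G\<^esub> f (s - m) \<otimes>\<^bsub>G\<^esub> f (m + n - s))"
          using cl by (simp add: m_assoc)
        from near_trans[OF this near_right[OF 1]]
        have "near (swap_cost l r i) (f m \<otimes>\<^bsub>G\<^esub> f n) (f s \<otimes>\<^bsub>G\<^esub> f (m + n - s))"
          using cl by (simp add: swap_cost_def)
        moreover have "f s \<in> overflow i j" using \<open>j \<noteq> 0\<close> by (auto simp: s_def f_def overflow_def)
        moreover have "f (m + n - s) \<in> \<phi> i j ` idx H N i j" using f_idx[OF s(3)] by (simp add: f_def)
        ultimately show ?thesis unfolding h mn f_def by blast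
      qed
    qed
  qed
qed

text \<open>The blocks of ranks are disjoint, so a rank below \<open>(Suc l - i) * W\<close> but not
  below \<open>(l - i) * W\<close> belongs to layer \<open>i\<close>.\<close>

lemma letters_layer:
  assumes i: "1 \<le> i" "i \<le> l"
  shows "U ((Suc l - i) * W) \<subseteq> U ((l - i) * W) \<union> layer_letters i \<union> m_inv G ` layer_letters i"
proof -
  have "letters l r H N \<phi> ((Suc l - i) * W) \<subseteq> letters l r H N \<phi> ((l - i) * W) \<union> layer_letters i"
  proof
    fix s assume "s \<in> letters l r H N \<phi> ((Suc l - i) * W)"
    then obtain k j x where k: "1 \<le> k" "k \<le> l" "j \<le> r k" "x \<in> idx H N k j"
      "(l - k) * W + j < (Suc l - i) * W" and s: "s = \<phi> k j x" by (auto simp: letters_def)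
    have "(l - k) * W < (Suc l - i) * W" by (rule le_less_trans[OF le_add1 k(5)])
    then have "l - k < Suc l - i" by (metis mult_less_cancel2)
    then have "i \<le> k" using k i by linarith
    show "s \<in> letters l r H N \<phi> ((l - i) * W) \<union> layer_letters i"
    proof (cases "k = i")
      case True
      then show ?thesis using k s by (auto simp: layer_letters_def)
    next
      case False
      then have "Suc (l - k) \<le> l - i" using \<open>i \<le> k\<close> k by linarith
      then have "Suc (l - k) * W \<le> (l - i) * W" by (rule mult_le_mono1)
      moreover have "j < W" using rank_less k by blast
      ultimately have "(l - k) * W + j < (l - i) * W" by simp
      then show ?thesis using k s by (auto simp: letters_def)
    qed
  qed
  then show ?thesis by (auto simp: sym_letters_def)
qed

lemma layer_cover:
  assumes i: "1 \<le> i" "i \<le> l"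
  shows "\<exists>Y. finite Y \<and> Y \<subseteq> carrier G \<and> card Y \<le> (n + 1) ^ (3 * Suc (r i)) \<and>
    P ((Suc l - i) * W) n \<subseteq> Y <#>\<^bsub>G\<^esub> (P ((l - i) * W) (cover_cost l r i n) <#>\<^bsub>G\<^esub> L i (r i))"
proof -
  interpret abelian_layer G "U ((l - i) * W)" "layer_letters i" "conj_cost l r i" "swap_cost l r i"
    "r i" "\<lambda>j. \<phi> i j ` idx H N i j" "overflow i"
    using i by (rule abelian_layer_interpretation)
  show ?thesis
    using cover[of n] set_power_mono_set[OF letters_layer[OF i], of G n]
    unfolding cover_cost_def Let_def step_cost_def perm_cost_def layer_upto_def
    by (meson order_trans)
qed

lemma finite_idx: "1 \<le> i \<Longrightarrow> i \<le> l \<Longrightarrow> finite (idx H N i j)"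
  using finite_H by (simp add: idx_def)

lemma finite_A: "1 \<le> i \<Longrightarrow> finite (A i)"
  unfolding layers_from_def layer_upto_def
  by (intro finite_set_prod) (auto simp del: upt_Suc intro!: finite_set_prod finite_imageI finite_idx)

lemma A_closed: "1 \<le> i \<Longrightarrow> A i \<subseteq> carrier G"
  using layers_from_subset P_closed by blast

lemma sym_power_subset: "sym_power G (A 1) n \<subseteq> P (l * W) (n * Suc (l * W))"
proof
  fix x assume x: "x \<in> sym_power G (A 1) n"
  have A: "a \<in> P (l * W) (l * W)" if "a \<in> A 1" for a using layers_from_subset[of 1] that by auto
  have "s \<in> P (l * W) (l * W)" if "s \<in> A 1 \<union> {\<one>\<^bsub>G\<^esub>} \<union> set_inv\<^bsub>G\<^esub> A 1" for s
    using that A P_inv by (auto simp: SET_INV_def intro: P_mono[where w = "l * W" and n = 0])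
  \<comment> \<open>Raising the length by one makes it positive even for \<open>l = 0\<close>;
    covering bounds are available only for positive lengths.\<close>
  then have "s \<in> P (l * W) (Suc (l * W))" if "s \<in> A 1 \<union> {\<one>\<^bsub>G\<^esub>} \<union> set_inv\<^bsub>G\<^esub> A 1" for s
    using that by (blast intro: P_mono[where w = "l * W" and n = "l * W"] le_refl le_SucI)
  then show "x \<in> P (l * W) (n * Suc (l * W))"
    using x unfolding sym_power_def by (intro set_power_power[OF U_closed])
qed

end

section \<open>Induction over the layers\<close>

text \<open>\<open>m\<close> counts the layers from \<open>l\<close> downwards. \<open>C\<close> and
  \<open>d\<close> are fixed before the group, the maps and \<open>n\<close>, so the induction keeps
  them uniform.\<close>

definition cover_bound ::
  "'a itself \<Rightarrow> 'h itself \<Rightarrow> nat \<Rightarrow> (nat \<Rightarrow> nat) \<Rightarrow> nat \<Rightarrow> nat \<Rightarrow> nat \<Rightarrow> bool" where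
  "cover_bound TA TH l r m C d \<longleftrightarrow>
     (\<forall>(G :: 'a monoid) (H :: nat \<Rightarrow> 'h monoid) N \<phi> n.
        coset_nilprogression G l r H N \<phi> \<longrightarrow> 1 \<le> n \<longrightarrow>
        (\<exists>X. finite X \<and> X \<subseteq> carrier G \<and> card X \<le> C * n ^ d \<and>
          set_power G (sym_letters G l r H N \<phi> (m * width l r)) n
            \<subseteq> X <#>\<^bsub>G\<^esub> layers_from G l r H N \<phi> (Suc l - m)))"

lemma cover_boundI:
  assumes "\<And>(G :: 'a monoid) (H :: nat \<Rightarrow> 'h monoid) N \<phi> n.
    \<lbrakk>coset_nilprogression G l r H N \<phi>; 1 \<le> n\<rbrakk> \<Longrightarrow>
    \<exists>X. finite X \<and> X \<subseteq> carrier G \<and> card X \<le> C * n ^ d \<and>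
      set_power G (sym_letters G l r H N \<phi> (m * width l r)) n
        \<subseteq> X <#>\<^bsub>G\<^esub> layers_from G l r H N \<phi> (Suc l - m)"
  shows "cover_bound TYPE('a) TYPE('h) l r m C d"
  unfolding cover_bound_def by (intro allI impI) (rule assms)

lemma cover_boundD:
  fixes G :: "'a monoid" and H :: "nat \<Rightarrow> 'h monoid"
  assumes "cover_bound TYPE('a) TYPE('h) l r m C d" "coset_nilprogression G l r H N \<phi>" "1 \<le> n"
  shows "\<exists>X. finite X \<and> X \<subseteq> carrier G \<and> card X \<le> C * n ^ d \<and>
    set_power G (sym_letters G l r H N \<phi> (m * width l r)) n
      \<subseteq> X <#>\<^bsub>G\<^esub> layers_from G l r H N \<phi> (Suc l - m)"
  using assms(1)[unfolded cover_bound_def, rule_format, OF assms(2,3)] .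

text \<open>\<open>layer_cover\<close> reduces words to polynomially longer words in later letters,
  to which the induction hypothesis applies. The layer \<open>L i (r i)\<close> split off on the
  right completes \<open>A (Suc i)\<close> to \<open>A i\<close>, and the two sets of translates are
  multiplied.\<close>

lemma ex_cover_bound: "m \<le> l \<Longrightarrow> \<exists>C d. cover_bound TYPE('a) TYPE('h) l r m C d"
proof (induction m)
  case 0
  have "cover_bound TYPE('a) TYPE('h) l r 0 1 0"
  proof (rule cover_boundI)
    fix G :: "'a monoid" and H :: "nat \<Rightarrow> 'h monoid" and N \<phi> and n :: nat
    assume "coset_nilprogression G l r H N \<phi>"
    then interpret coset_nilprogression G l r H N \<phi> .
    have "set_power G {\<one>\<^bsub>G\<^esub>} n = {\<one>\<^bsub>G\<^esub>}" by (induction n) (auto simp: set_mult_def)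
    then show "\<exists>X. finite X \<and> X \<subseteq> carrier G \<and> card X \<le> 1 * n ^ 0 \<and> P (0 * W) n \<subseteq> X <#>\<^bsub>G\<^esub> A (Suc l - 0)"
      by (intro exI[of _ "{\<one>\<^bsub>G\<^esub>}"]) (auto simp: layers_from_last sym_letters_def letters_def mem_set_mult)
  qed
  then show ?case by blast
next
  case (Suc m)
  define i where "i = l - m"
  have i: "1 \<le> i" "i \<le> l" "l - i = m" "Suc l - i = Suc m" "Suc l - m = Suc i" "Suc l - Suc m = i"
    using Suc.prems by (auto simp: i_def)
  obtain C d where IH: "cover_bound TYPE('a) TYPE('h) l r m C d"
    using Suc by auto
  obtain C' d' where cost: "\<And>n. n \<ge> 1 \<Longrightarrow> cover_cost l r i n \<le> C' * n ^ d'"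
    using poly_bounded_cover_cost unfolding poly_bounded_def by blast
  define f where "f n = (n + 1) ^ (3 * Suc (r i)) * (C * (Suc C' * n ^ d') ^ d)" for n :: nat
  have "poly_bounded f" unfolding f_def[abs_def] by (intro poly_bounded_intros)
  then obtain C'' d'' where f: "\<And>n. n \<ge> 1 \<Longrightarrow> f n \<le> C'' * n ^ d''"
    unfolding poly_bounded_def by blast
  have "cover_bound TYPE('a) TYPE('h) l r (Suc m) C'' d''"
  proof (rule cover_boundI)
    fix G :: "'a monoid" and H :: "nat \<Rightarrow> 'h monoid" and N \<phi> and n :: nat
    assume np: "coset_nilprogression G l r H N \<phi>" and n: "1 \<le> n"
    interpret coset_nilprogression G l r H N \<phi> by fact
    \<comment> \<open>\<open>Suc C'\<close> instead of \<open>C'\<close> makes the length positive,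
      as the induction hypothesis demands.\<close>
    let ?q = "Suc C' * n ^ d'"
    have q: "1 \<le> ?q" "cover_cost l r i n \<le> ?q" using cost[OF n] n by (auto simp: Suc_le_eq)
    obtain Y where Y: "finite Y" "Y \<subseteq> carrier G" "card Y \<le> (n + 1) ^ (3 * Suc (r i))"
      "P (Suc m * W) n \<subseteq> Y <#>\<^bsub>G\<^esub> (P (m * W) (cover_cost l r i n) <#>\<^bsub>G\<^esub> L i (r i))"
      using layer_cover[OF i(1,2), of n] unfolding i(3,4) by blast
    obtain X where X: "finite X" "X \<subseteq> carrier G" "card X \<le> C * ?q ^ d"
      "P (m * W) ?q \<subseteq> X <#>\<^bsub>G\<^esub> A (Suc i)"
      using cover_boundD[OF IH np q(1)] unfolding i(5) by blast
    have "P (m * W) (cover_cost l r i n) \<subseteq> X <#>\<^bsub>G\<^esub> A (Suc i)"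
      using X(4) q(2) P_mono by blast
    then have "P (Suc m * W) n \<subseteq> Y <#>\<^bsub>G\<^esub> ((X <#>\<^bsub>G\<^esub> A (Suc i)) <#>\<^bsub>G\<^esub> L i (r i))"
      using Y(4) mono_set_mult[of Y Y] mono_set_mult[of _ "X <#>\<^bsub>G\<^esub> A (Suc i)" "L i (r i)" "L i (r i)"]
      by (meson order_refl order_trans)
    also have "\<dots> = (Y <#>\<^bsub>G\<^esub> X) <#>\<^bsub>G\<^esub> A i"
      using X(2) Y(2) A_closed L_closed[OF i(1,2) order_refl]
      by (simp add: layers_from_Suc[OF i(1,2)] set_mult_assoc set_mult_closed)
    finally have sub: "P (Suc m * W) n \<subseteq> (Y <#>\<^bsub>G\<^esub> X) <#>\<^bsub>G\<^esub> A i" .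
    have "card (Y <#>\<^bsub>G\<^esub> X) \<le> card Y * card X" using X Y by (intro card_set_mult_le)
    also have "\<dots> \<le> f n" unfolding f_def using X Y by (intro mult_le_mono)
    also have "\<dots> \<le> C'' * n ^ d''" using f[OF n] .
    finally show "\<exists>X. finite X \<and> X \<subseteq> carrier G \<and> card X \<le> C'' * n ^ d'' \<and>
        P (Suc m * W) n \<subseteq> X <#>\<^bsub>G\<^esub> A (Suc l - Suc m)"
      using sub X(1,2) Y(1,2) unfolding i(6)
      by (intro exI[of _ "Y <#>\<^bsub>G\<^esub> X"]) (auto simp: finite_set_mult set_mult_closed)
  qed
  then show ?case by blast
qed

text \<open>The factors of a symmetric power are words of length at most \<open>K\<close>, so the
  case \<open>m = l\<close> covers the power by translates of \<open>A\<close>; \<open>K ^ d\<close>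
  is absorbed into the constant.\<close>

theorem ex_growth_bound: "\<exists>C d. growth_bound TYPE('a) TYPE('h) l r C d"
proof -
  define K where "K = Suc (l * width l r)"
  obtain C d where cov: "cover_bound TYPE('a) TYPE('h) l r l C d"
    using ex_cover_bound[of l l] by blast
  have "growth_bound TYPE('a) TYPE('h) l r (real (C * K ^ d)) d"
    unfolding growth_bound_def
  proof (intro allI impI)
    fix G :: "'a monoid" and H :: "nat \<Rightarrow> 'h monoid" and N \<phi> A and n :: nat
    assume np: "coset_nilprogression G l r H N \<phi>" and A: "A = layers_from G l r H N \<phi> 1" and n: "1 \<le> n"
    interpret np: coset_nilprogression G l r H N \<phi> by fact
    have "1 \<le> n * K" using n by (simp add: K_def)
    from cover_boundD[OF cov np this] obtain X where X: "finite X" "card X \<le> C * (n * K) ^ d"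
      "np.P (l * width l r) (n * K) \<subseteq> X <#>\<^bsub>G\<^esub> A" unfolding A by auto
    have "sym_power G A n \<subseteq> X <#>\<^bsub>G\<^esub> A"
      using np.sym_power_subset[of n] X(3) unfolding A K_def by blast
    then have "card (sym_power G A n) \<le> card (X <#>\<^bsub>G\<^esub> A)"
      using X(1) np.finite_A[of 1] A by (intro card_mono finite_set_mult) auto
    also have "\<dots> \<le> card X * card A"
      using X(1) np.finite_A[of 1] A by (intro card_set_mult_le) auto
    also have "\<dots> \<le> (C * (n * K) ^ d) * card A" using X(2) by simp
    finally have "card (sym_power G A n) \<le> C * K ^ d * n ^ d * card A"
      by (simp add: power_mult_distrib mult_ac)
    then have "real (card (sym_power G A n)) \<le> real (C * K ^ d * n ^ d * card A)"
      by (rule of_nat_mono)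
    then show "real (card (sym_power G A n)) \<le> real (C * K ^ d) * real n ^ d * real (card A)"
      by simp
  qed
  then show ?thesis by blast
qed

section \<open>Independence of the types\<close>

definition image_monoid :: "('a \<Rightarrow> 'b) \<Rightarrow> 'a set \<Rightarrow> 'a monoid \<Rightarrow> 'b monoid" where
  "image_monoid f K G =
     \<lparr>carrier = f ` K, monoid.mult = \<lambda>x y. f (inv_into K f x \<otimes>\<^bsub>G\<^esub> inv_into K f y), one = f \<one>\<^bsub>G\<^esub>\<rparr>"

text \<open>Injectivity is asked on a subgroup only, since the whole carrier may be too large to
  embed into the target type.\<close>

locale group_transport = monoid_group G for G :: "'a monoid" (structure) +
  fixes K :: "'a set" and f :: "'a \<Rightarrow> 'b"
  assumes K: "subgroup K G" and inj: "inj_on f K"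
begin

interpretation K: subgroup K G by (fact K)

abbreviation G' where "G' \<equiv> image_monoid f K G"

lemma carrier_image: "carrier G' = f ` K"
  and one_image: "\<one>\<^bsub>G'\<^esub> = f \<one>"
  by (simp_all add: image_monoid_def)

lemma mult_image: "\<lbrakk>x \<in> K; y \<in> K\<rbrakk> \<Longrightarrow> f x \<otimes>\<^bsub>G'\<^esub> f y = f (x \<otimes> y)"
  using inj by (simp add: image_monoid_def)

lemma group_image: "group G'"
proof (rule groupI)
  fix x assume "x \<in> carrier G'"
  then obtain a where a: "a \<in> K" "x = f a" by (auto simp: carrier_image)
  then show "\<one>\<^bsub>G'\<^esub> \<otimes>\<^bsub>G'\<^esub> x = x" by (simp add: one_image mult_image)
  show "\<exists>y\<in>carrier G'. y \<otimes>\<^bsub>G'\<^esub> x = \<one>\<^bsub>G'\<^esub>"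
    using a by (intro bexI[of _ "f (inv a)"]) (simp_all add: one_image mult_image carrier_image)
qed (auto simp: carrier_image one_image mult_image m_assoc)

lemma comm_group_image:
  assumes "comm_group G"
  shows "comm_group G'"
proof -
  interpret comm_group G by fact
  interpret G': group G' by (fact group_image)
  show ?thesis
    by (rule G'.group_comm_groupI) (auto simp: carrier_image mult_image m_comm)
qed

lemma inv_image: "x \<in> K \<Longrightarrow> inv\<^bsub>G'\<^esub> f x = f (inv x)"
  by (rule group.inv_equality[OF group_image]) (simp_all add: carrier_image one_image mult_image)

lemma commutator_image:
  "\<lbrakk>x \<in> K; y \<in> K\<rbrakk> \<Longrightarrow> commutator G' (f x) (f y) = f (commutator G x y)"
  by (simp add: commutator_def mult_image inv_image)

lemma set_mult_image: "\<lbrakk>X \<subseteq> K; Y \<subseteq> K\<rbrakk> \<Longrightarrow> f ` X <#>\<^bsub>G'\<^esub> f ` Y = f ` (X <#> Y)"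
  unfolding set_mult_def by (force simp: mult_image subset_iff)

lemma set_mult_subset: "\<lbrakk>X \<subseteq> K; Y \<subseteq> K\<rbrakk> \<Longrightarrow> X <#> Y \<subseteq> K"
  by (auto simp: set_mult_def)

lemma set_prod_subset: "(\<And>X. X \<in> set Xs \<Longrightarrow> X \<subseteq> K) \<Longrightarrow> set_prod G Xs \<subseteq> K"
  by (induction Xs) (simp_all add: set_mult_subset)

lemma set_prod_image:
  "(\<And>X. X \<in> set Xs \<Longrightarrow> X \<subseteq> K) \<Longrightarrow> set_prod G' (map ((`) f) Xs) = f ` set_prod G Xs"
  by (induction Xs) (simp_all add: one_image set_mult_image set_prod_subset)

lemma sym_power_image:
  assumes "X \<subseteq> K"
  shows "sym_power G' (f ` X) n = f ` sym_power G X n" "sym_power G X n \<subseteq> K"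
proof -
  let ?S = "X \<union> {\<one>} \<union> set_inv X"
  have sub: "?S \<subseteq> K" using assms by (auto simp: SET_INV_def)
  have "f ` X \<union> {\<one>\<^bsub>G'\<^esub>} \<union> set_inv\<^bsub>G'\<^esub> (f ` X) = f ` ?S"
    using assms by (force simp: SET_INV_def one_image inv_image image_iff subset_iff)
  then show "sym_power G' (f ` X) n = f ` sym_power G X n"
    unfolding sym_power_def using set_prod_image[of "replicate n ?S"] sub by simp
  show "sym_power G X n \<subseteq> K"
    unfolding sym_power_def using sub by (intro set_prod_subset) auto
qed

end

text \<open>Every element of the generated subgroup is the value of a finite word in
  \<open>S\<close> and its inverses, and there are countably many such words.\<close>

lemma (in group) countable_generate:
  assumes "countable S" "S \<subseteq> carrier G"
  shows "countable (generate G S)"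
proof -
  let ?T = "S \<union> m_inv G ` S"
  have T: "?T \<subseteq> carrier G" using assms by auto
  have "generate G S \<subseteq> lprod G ` lists ?T"
  proof
    fix x assume "x \<in> generate G S"
    then show "x \<in> lprod G ` lists ?T"
    proof induction
      case one
      then show ?case by (intro image_eqI[of _ _ "[]"]) auto
    next
      case (incl h)
      then show ?case using assms(2) by (intro image_eqI[of _ _ "[h]"]) auto
    next
      case (inv h)
      then show ?case using assms(2) by (intro image_eqI[of _ _ "[inv h]"]) auto
    next
      case (eng x y)
      then obtain xs ys where xy: "set xs \<subseteq> ?T" "set ys \<subseteq> ?T" "x = lprod G xs" "y = lprod G ys"
        by (auto simp: lists_eq_set)
      then have "x \<otimes> y = lprod G (xs @ ys)"
        using T by (subst lprod_append) (auto dest: subset_trans)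
      then show ?case using xy by (intro image_eqI[of _ _ "xs @ ys"]) (auto simp: lists_eq_set)
    qed
  qed
  moreover have "countable (lprod G ` lists ?T)"
    using assms(1) by (intro countable_image countable_lists) auto
  ultimately show ?thesis by (rule countable_subset)
qed

locale nilprogression_transport = coset_nilprogression G l r H N \<phi> + group_transport G K f
  for G :: "'a monoid" and l r and H :: "nat \<Rightarrow> 'h monoid" and N \<phi> K and f :: "'a \<Rightarrow> 'b" +
  fixes h :: "nat \<Rightarrow> 'h \<Rightarrow> 'k"
  assumes inj_h: "\<lbrakk>1 \<le> i; i \<le> l\<rbrakk> \<Longrightarrow> inj_on (h i) (carrier (H i))"
    and phi_K: "\<lbrakk>1 \<le> i; i \<le> l; j \<le> r i; x \<in> idx H N i j\<rbrakk> \<Longrightarrow> \<phi> i j x \<in> K"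
begin

definition H' :: "nat \<Rightarrow> 'k monoid" where
  "H' i = image_monoid (h i) (carrier (H i)) (H i)"

definition \<phi>' :: "nat \<Rightarrow> nat \<Rightarrow> 'k + int \<Rightarrow> 'b" where
  "\<phi>' i j x = f (\<phi> i j (map_sum (inv_into (carrier (H i)) (h i)) id x))"

abbreviation \<iota> where "\<iota> i \<equiv> map_sum (h i) id"

lemma idx_image: "idx H' N i j = \<iota> i ` idx H N i j"
  by (auto simp: idx_def H'_def image_monoid_def image_image)

context
  fixes i assumes i: "1 \<le> i" "i \<le> l"
begin

interpretation Hi: group_transport "H i" "carrier (H i)" "h i"
proof -
  interpret comm_group "H i" using comm_group_H i .
  show "group_transport (H i) (carrier (H i)) (h i)"
    using inj_h i subgroup_self is_group
    by (intro group_transport.intro monoid_group.intro group_transport_axioms.intro)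
qed

lemma comm_group_H': "comm_group (H' i)"
  unfolding H'_def using comm_group_H i by (intro Hi.comm_group_image)

lemma phi_image:
  assumes "x \<in> idx H N i j"
  shows "\<phi>' i j (\<iota> i x) = f (\<phi> i j x)"
  using assms inj_h[OF i] by (auto simp: \<phi>'_def idx_def split: if_splits)

lemma phi_image_set: "\<phi>' i j ` idx H' N i j = f ` \<phi> i j ` idx H N i j"
  unfolding idx_image image_image using phi_image by (intro image_cong) auto

lemma idx_zero_image: "idx_zero H' i j = \<iota> i (idx_zero H i j)"
  by (simp add: idx_zero_def H'_def image_monoid_def)

lemma idx_add_image:
  assumes "x \<in> idx H N i j" "y \<in> idx H N i j"
  shows "idx_add H' i (\<iota> i x) (\<iota> i y) = \<iota> i (idx_add H i x y)"
  using assms by (auto simp: idx_def idx_add_def H'_def Hi.mult_image split: if_splits)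

text \<open>\<open>phi_add\<close> speaks only of sums inside the index set, so membership must be
  pulled back: for \<open>j = 0\<close> it follows from closure of the group, and integers are not
  relabelled.\<close>

lemma idx_add_image_mem:
  assumes xy: "x \<in> idx H N i j" "y \<in> idx H N i j"
    and "idx_add H' i (\<iota> i x) (\<iota> i y) \<in> idx H' N i j"
  shows "idx_add H i x y \<in> idx H N i j"
proof (cases "j = 0")
  case True
  then show ?thesis using xy by (auto simp: idx_def idx_add_def)
next
  case False
  then show ?thesis using assms by (auto simp: idx_def idx_add_def)
qed

lemma layer_subset: "j \<le> r i \<Longrightarrow> L i j \<subseteq> K"
  unfolding layer_upto_def using phi_K i
  by (intro set_prod_subset) (auto simp del: upt_Suc)

lemma layer_image:
  assumes "j \<le> r i"
  shows "layer_upto G' H' N \<phi>' i j = f ` L i j"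
proof -
  have "layer_upto G' H' N \<phi>' i j
      = set_prod G' (map ((`) f) (map (\<lambda>j. \<phi> i j ` idx H N i j) [0..<Suc j]))"
    unfolding layer_upto_def map_map comp_def phi_image_set ..
  also have "\<dots> = f ` L i j"
    unfolding layer_upto_def using phi_K i assms
    by (intro set_prod_image) (auto simp del: upt_Suc)
  finally show ?thesis .
qed

end

lemma layers_subset: "1 \<le> i \<Longrightarrow> A i \<subseteq> K"
  unfolding layers_from_def
  by (intro set_prod_subset) (auto simp del: upt_Suc dest!: subsetD[OF layer_subset, rotated 3])

lemma layers_image:
  assumes "1 \<le> i"
  shows "layers_from G' l r H' N \<phi>' i = f ` A i"
proof -
  have "layers_from G' l r H' N \<phi>' i
      = set_prod G' (map ((`) f) (map (\<lambda>k. L k (r k)) (rev [i..<Suc l])))"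
    unfolding layers_from_def map_map comp_def using assms
    by (intro arg_cong[where f = "set_prod G'"] map_cong refl layer_image) auto
  also have "\<dots> = f ` A i"
    unfolding layers_from_def using assms layer_subset
    by (intro set_prod_image) (auto simp del: upt_Suc dest!: subsetD[OF layer_subset, rotated 3])
  finally show ?thesis .
qed

text \<open>All product sets in the axioms lie in \<open>K\<close>, where \<open>f\<close> is an
  injective homomorphism. Each axiom is pulled back along the relabelling, applied, and pushed
  forward again.\<close>

lemma coset_nilprogression_image: "coset_nilprogression G' l r H' N \<phi>'"
proof (rule coset_nilprogression.intro)
  show "group G'" by (fact group_image)
next
  fix i assume i: "1 \<le> i" "i \<le> l"
  show "comm_group (H' i)" using i by (rule comm_group_H')
  show "finite (carrier (H' i))" using finite_H[OF i] by (simp add: H'_def image_monoid_def)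
next
  fix i j x assume i: "1 \<le> i" "i \<le> l" "j \<le> r i" "x \<in> idx H' N i j"
  then show "\<phi>' i j x \<in> carrier G'"
    using phi_image[OF i(1,2)] phi_K[OF i(1-3)] by (auto simp: idx_image carrier_image)
next
  fix i j assume i: "1 \<le> i" "i \<le> l" "j \<le> r i"
  then show "\<phi>' i j (idx_zero H' i j) = \<one>\<^bsub>G'\<^esub>"
    using phi_image[OF i(1,2) idx_zero_mem] phi_zero[OF i] by (simp add: idx_zero_image one_image)
next
  fix i j x' y'
  assume i: "1 \<le> i" "i \<le> l" "j \<le> r i" and xy': "x' \<in> idx H' N i j" "y' \<in> idx H' N i j"
    and add: "idx_add H' i x' y' \<in> idx H' N i j"
  obtain x y where x: "x \<in> idx H N i j" "x' = \<iota> i x" and y: "y \<in> idx H N i j" "y' = \<iota> i y"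
    using xy' by (auto simp: idx_image)
  have mem: "idx_add H i x y \<in> idx H N i j"
    using idx_add_image_mem[OF i(1,2) x(1) y(1)] add x y by simp
  have "\<phi>' i j x' \<otimes>\<^bsub>G'\<^esub> \<phi>' i j y' = f (\<phi> i j x \<otimes>\<^bsub>G\<^esub> \<phi> i j y)"
    using x y i phi_K by (simp add: phi_image mult_image)
  also have "\<dots> \<in> f ` (A (i + 1) <#>\<^bsub>G\<^esub> {\<phi> i j (idx_add H i x y)})"
    using phi_add[OF i x(1) y(1) mem] by blast
  also have "\<dots> = f ` A (i + 1) <#>\<^bsub>G'\<^esub> f ` {\<phi> i j (idx_add H i x y)}"
    using layers_subset[of "i + 1"] phi_K[OF i mem] by (intro set_mult_image[symmetric]) auto
  also have "\<dots> = layers_from G' l r H' N \<phi>' (i + 1) <#>\<^bsub>G'\<^esub> {\<phi>' i j (idx_add H' i x' y')}"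
    using x y i mem layers_image[of "i + 1"] by (simp add: idx_add_image[of i _ j] phi_image)
  finally show "\<phi>' i j x' \<otimes>\<^bsub>G'\<^esub> \<phi>' i j y'
    \<in> layers_from G' l r H' N \<phi>' (i + 1) <#>\<^bsub>G'\<^esub> {\<phi>' i j (idx_add H' i x' y')}" .
next
  fix i j j' x' y'
  assume i: "1 \<le> i" "i \<le> l" "j \<le> r i" "j' \<le> r i"
    and xy': "x' \<in> idx H' N i j" "y' \<in> idx H' N i j'"
  obtain x y where x: "x \<in> idx H N i j" "x' = \<iota> i x" and y: "y \<in> idx H N i j'" "y' = \<iota> i y"
    using xy' by (auto simp: idx_image)
  have "commutator G' (\<phi>' i j x') (\<phi>' i j' y') = f (commutator G (\<phi> i j x) (\<phi> i j' y))"
    using x y i phi_K by (simp add: phi_image commutator_image)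
  then show "commutator G' (\<phi>' i j x') (\<phi>' i j' y') \<in> layers_from G' l r H' N \<phi>' (i + 1)"
    using phi_commutator_same[OF i x(1) y(1)] layers_image[of "i + 1"] by simp
next
  fix i' i j j' x' y'
  assume i: "1 \<le> i'" "i' < i" "i \<le> l" "j \<le> r i" "j' \<le> r i'"
    and xy': "x' \<in> idx H' N i j" "y' \<in> idx H' N i' j'"
  obtain x y where x: "x \<in> idx H N i j" "x' = \<iota> i x" and y: "y \<in> idx H N i' j'" "y' = \<iota> i' y"
    using xy' by (auto simp: idx_image)
  have "commutator G' (\<phi>' i' j' y') (\<phi>' i j x') = f (commutator G (\<phi> i' j' y) (\<phi> i j x))"
    using x y i phi_K by (simp add: phi_image commutator_image)
  also have "\<dots> \<in> f ` (A (i + 1) <#>\<^bsub>G\<^esub> L i (j - 1))"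
    using phi_commutator_lower[OF i x(1) y(1)] by blast
  also have "\<dots> = f ` A (i + 1) <#>\<^bsub>G'\<^esub> f ` L i (j - 1)"
    using layers_subset[of "i + 1"] layer_subset[of i "j - 1"] i
    by (intro set_mult_image[symmetric]) auto
  also have "\<dots> = layers_from G' l r H' N \<phi>' (i + 1) <#>\<^bsub>G'\<^esub> layer_upto G' H' N \<phi>' i (j - 1)"
    using i layers_image[of "i + 1"] layer_image[of i "j - 1"] by simp
  finally show "commutator G' (\<phi>' i' j' y') (\<phi>' i j x')
    \<in> layers_from G' l r H' N \<phi>' (i + 1) <#>\<^bsub>G'\<^esub> layer_upto G' H' N \<phi>' i (j - 1)" .
qed

end

text \<open>A coset nilprogression is finite, so it lives in a countable subgroup, and this subgroup
  can be relabelled by natural numbers.\<close>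

lemma growth_bound_nat_imp:
  assumes "growth_bound TYPE(nat) TYPE(nat) l r C d"
  shows "growth_bound TYPE('a) TYPE('h) l r C d"
  unfolding growth_bound_def
proof (intro allI impI)
  fix G :: "'a monoid" and H :: "nat \<Rightarrow> 'h monoid" and N \<phi> A and n :: nat
  assume np: "coset_nilprogression G l r H N \<phi>" and A: "A = layers_from G l r H N \<phi> 1" and n: "1 \<le> n"
  interpret np: coset_nilprogression G l r H N \<phi> by fact
  define S where "S = (\<Union>i\<in>{1..l}. \<Union>j\<le>r i. \<phi> i j ` idx H N i j)"
  define K where "K = generate G S"
  have S: "S \<subseteq> carrier G" "finite S"
    using np.phi_closed np.finite_idx by (auto simp: S_def)
  have K: "subgroup K G" "countable K"
    unfolding K_def using S
    by (auto intro: np.generate_is_subgroup np.countable_generate countable_finite)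
  interpret nilprogression_transport G l r H N \<phi> K "to_nat_on K" "\<lambda>i. to_nat_on (carrier (H i))"
  proof (intro nilprogression_transport.intro group_transport.intro
      group_transport_axioms.intro nilprogression_transport_axioms.intro)
    show "\<phi> i j x \<in> K" if "1 \<le> i" "i \<le> l" "j \<le> r i" "x \<in> idx H N i j" for i j x
      unfolding K_def S_def using that by (intro generate.incl UN_I[of i] UN_I[of j]) auto
  qed (use K np np.monoid_group_axioms np.finite_H in
      \<open>auto intro: inj_on_to_nat_on countable_finite\<close>)
  have sub: "A \<subseteq> K" unfolding A by (rule layers_subset) simp
  \<comment> \<open>\<open>A\<close> and its symmetric powers lie in \<open>K\<close>, where the
    relabelling is injective, so both cardinalities in the bound are unchanged.\<close>
  have card: "card (to_nat_on K ` X) = card X" if "X \<subseteq> K" for X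
    using inj_on_subset[OF inj that] by (rule card_image)
  have "real (card (sym_power G' (to_nat_on K ` A) n)) \<le> C * real n ^ d * real (card (to_nat_on K ` A))"
    using assms[unfolded growth_bound_def, rule_format, OF coset_nilprogression_image _ n] layers_image
    unfolding A by simp
  then show "real (card (sym_power G A n)) \<le> C * real n ^ d * real (card A)"
    using sym_power_image[OF sub] sub by (simp add: card)
qed

text \<open>The constants are chosen once, over \<open>nat\<close>, and the same pair is carried to
  arbitrary types; this expresses that they depend on \<open>l\<close> and \<open>r\<close>
  alone.\<close>

theorem lemma1p16:
  fixes l :: nat and r :: "nat \<Rightarrow> nat"
  shows "(\<exists>C d. growth_bound TYPE(nat) TYPE(nat) l r C d) \<and>
         (\<forall>C d. growth_bound TYPE(nat) TYPE(nat) l r C d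
              \<longrightarrow> growth_bound TYPE('a) TYPE('h) l r C d)"
  using ex_growth_bound growth_bound_nat_imp by blast

end
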